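(* Let $\mathcal X\subseteq C_{\mathfrak m}(\tilde{\mathcal F}_t)$, $\mathfrak m\in\mathfrak M$, be bounded from below, and define $$X^\ast:=\varphi^\ast(\tilde W^t)\in C_{\mathfrak m}(\tilde{\mathcal F}_t),$$ where $\varphi^\ast$ is the pointwise infimum over all functions $\varphi:C_0([0,T];\mathbb R^d)\to\mathbb R$ satisfying $\varphi(\tilde W^t)\in\mathcal X$. Then, for any $\theta\in\Theta$, there exists a sequence $(X^n)$ in $\mathcal X$ such that $$X^\ast(\theta)=\Big(\inf_{n\in\mathbb N}X^n\Big)(\theta).$$ If in addition the set $\{\mu^\theta:\theta\in\Theta\}$ is relatively weak$^\ast$-compact (that is, relatively compact for the $\sigma(\mathcal M_1,C_b)$-topology on the probability measures over the Polish space $C_0([0,T];\mathbb R^d)$), then there exists a sequence $(X^n)$ in $\mathcal X$ such that for every $\varepsilon>0$ it holds $$\lim_{n\to\infty}\tilde P\big[(X^1\wedge\cdots\wedge X^n)-X^\ast>\varepsilon\big]=0.$$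
   Context: $T>0$ is a finite time horizon and $t\in[0,T]$; $(\Omega,\mathcal F,P)$ is a probability space carrying a $d$-dimensional Brownian motion $W$; $(\mathcal F_t)$ is the augmented filtration generated by $W$. $L^0(\mathcal F_t)$ is the set of $\mathcal F_t$-measurable random variables on $\Omega$, identified when they coincide $P$-almost surely. $\Theta$ is a given family of progressively measurable processes $\theta:\Omega\times[0,T]\to\mathbb S_d^{>0}$ (strictly positive definite $d\times d$ matrices) with $\int_0^T\|\theta_u^{1/2}\|^2du<\infty$ $P$-almost surely. Put $\tilde\Omega:=\Omega\times\Theta$ and let $\tilde W:\tilde\Omega\times[0,T]\to\mathbb R^d$ be the stochastic integral $\tilde W(\theta)=\int\theta^{1/2}dW$, $\theta\in\Theta$. Let $\tilde{\mathcal F}_t:=\sigma(\tilde W_s;s\le t)$. For a random variable $X$ on $\tilde\Omega$, $X(\theta)$ denotes its section at $\theta$, a random variable on $\Omega$ (equalities between such sections are understood $P$-almost surely); for $A\subseteq\tilde\Omega$, $A(\theta)=\{\omega\in\Omega:(\omega,\theta)\in A\}$. For $A\in\tilde{\mathcal F}_T$, $P^\theta[A]:=P[A(\theta)]$ and $\tilde P[A]:=\sup_{\theta\in\Theta}P^\theta[A]$. $C_0([0,T];\mathbb R^d)$ is the space of continuous $w:[0,T]\to\mathbb R^d$ with $w(0)=0$, equipped with the uniform norm $\|\cdot\|_\infty$; $\mu^\theta[B]:=P[\tilde W(\theta)\in B]$ for Borel $B\subseteq C_0([0,T];\mathbb R^d)$. $\mathcal M_1$ denotes the probability measures and $C_b$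 the bounded continuous functions on $C_0([0,T];\mathbb R^d)$. A set $A\subseteq\tilde\Omega$ is polar if $A\subseteq B$ for some $B\in\tilde{\mathcal F}_T$ with $\tilde P[B]=0$; a property holds quasi-surely if it holds outside a polar set, i.e. $P^\theta$-almost surely for all $\theta\in\Theta$. $L^0(\tilde{\mathcal F}_t)$ is the set of $\tilde{\mathcal F}_t$-measurable $X:\tilde\Omega\to\mathbb R$, identified when they coincide quasi-surely; equalities and inequalities between $\tilde{\mathcal F}_t$-measurable random variables are understood quasi-surely. For every $X\in L^0(\tilde{\mathcal F}_t)$ there is a measurable $\varphi:C_0([0,T];\mathbb R^d)\to\mathbb R$ with $X=\varphi(\tilde W^t)$, where $\tilde W^t_s:=\tilde W_{s\wedge t}$. $\mathfrak M$ is a fixed arbitrary countable set of moduli of continuity, i.e. functions $\mathfrak m:[0,\infty]\to[0,\infty]$ with $\mathfrak m(0)=0$ and $\mathfrak m$ continuous at $0$. For $\mathfrak m\in\mathfrak M$, $C_{\mathfrak m}(\tilde{\mathcal F}_t)$ is the set of those $X=\varphi(\tilde W^t)\in L^0(\tilde{\mathcal F}_t)$ where $\varphi$ has modulus of continuity $\mathfrak m$, that is, $|\varphi(w)-\varphi(w')|\le\mathfrak m(\|w-w'\|_\infty)$ for all $w,w'\in C_0([0,T];\mathbb R^d)$.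
   Formalization: The infimum φ* is taken only over functions φ having modulus of continuity m with φ(W̃^t) in 𝒳 (over all functions it would be −∞, as φ can be changed on polar sets of paths); φ* may be −∞ at some paths, X* is then q.s. a real element of C_m; 𝒳 is assumed nonempty. *)

theory Defs
  imports "HOL-Probability.Probability"
begin

section \<open>Brownian motion and the stochastic integral\<close>

definition generated_sigma ::
  "'a set \<Rightarrow> 'i set \<Rightarrow> ('i \<Rightarrow> 'a \<Rightarrow> 'b::topological_space) \<Rightarrow> 'a measure" where
  "generated_sigma \<Omega> I X = sigma \<Omega> (\<Union>i\<in>I. {X i -` B \<inter> \<Omega> | B. B \<in> sets borel})"

definition brownian_motion :: "'a measure \<Rightarrow> real \<Rightarrow> (real \<Rightarrow> 'a \<Rightarrow> real^'d) \<Rightarrow> bool" where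
  "brownian_motion M T W \<longleftrightarrow>
     (\<forall>s\<in>{0..T}. W s \<in> borel_measurable M) \<and>
     (AE \<omega> in M. W 0 \<omega> = 0) \<and>
     (AE \<omega> in M. continuous_on {0..T} (\<lambda>s. W s \<omega>)) \<and>
     (\<forall>s u. 0 \<le> s \<and> s < u \<and> u \<le> T \<longrightarrow>
        prob_space.indep_set M
          (sets (generated_sigma (space M) {0..s} W))
          (sets (generated_sigma (space M) UNIV (\<lambda>_::unit. \<lambda>\<omega>. W u \<omega> - W s \<omega>))) \<and>
        prob_space.indep_vars M (\<lambda>_. borel) (\<lambda>i \<omega>. (W u \<omega> - W s \<omega>) $ i) UNIV \<and>
        (\<forall>i. distributed M lborel (\<lambda>\<omega>. (W u \<omega> - W s \<omega>) $ i) (normal_density 0 (sqrt (u - s)))))"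

text \<open>The augmentation adds all subsets of \<open>P\<close>-null sets. As these need not belong to
  \<open>sets M\<close>, probabilities of events of the augmented filtration are always taken
  under \<open>completion M\<close>, which has the same measurable sets as \<open>M\<close> if \<open>M\<close> is complete.\<close>

definition augmented_filtration ::
  "'a measure \<Rightarrow> (real \<Rightarrow> 'a \<Rightarrow> real^'d) \<Rightarrow> real \<Rightarrow> 'a measure" where
  "augmented_filtration M W t =
     sigma (space M) (sets (generated_sigma (space M) {0..t} W) \<union> null_sets (completion M))"

definition progressively_measurable ::
  "real \<Rightarrow> (real \<Rightarrow> 'a measure) \<Rightarrow> (real \<Rightarrow> 'a \<Rightarrow> 'b::topological_space) \<Rightarrow> bool" where
  "progressively_measurable T F H \<longleftrightarrow>
     (\<forall>t\<in>{0..T}. (\<lambda>(s, \<omega>). H s \<omega>) \<in> borel_measurable (restrict_space borel {0..t} \<Otimes>\<^sub>M F t))"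

definition pos_definite :: "real^'d^'d \<Rightarrow> bool" where
  "pos_definite A \<longleftrightarrow> transpose A = A \<and> (\<forall>x. x \<noteq> 0 \<longrightarrow> 0 < x \<bullet> (A *v x))"

definition matrix_sqrt :: "real^'d^'d \<Rightarrow> real^'d^'d" where
  "matrix_sqrt A = (THE B. pos_definite B \<and> B ** B = A)"

text \<open>The triple \<open>n\<close>, \<open>\<tau>\<close>, \<open>\<xi>\<close> encodes the simple process
  \<open>\<Sum>i<n. \<xi> i\<close> times the indicator of the half-open interval from \<open>\<tau> i\<close> to \<open>\<tau> (Suc i)\<close>.\<close>

definition simple_process ::
  "real \<Rightarrow> (real \<Rightarrow> 'a measure) \<Rightarrow> nat \<Rightarrow> (nat \<Rightarrow> real) \<Rightarrow> (nat \<Rightarrow> 'a \<Rightarrow> real^'d^'d) \<Rightarrow> bool" where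
  "simple_process T F n \<tau> \<xi> \<longleftrightarrow>
     mono_on {..n} \<tau> \<and> \<tau> ` {..n} \<subseteq> {0..T} \<and>
     (\<forall>i<n. \<xi> i \<in> borel_measurable (F (\<tau> i)) \<and> bounded (\<xi> i ` space (F (\<tau> i))))"

definition simple_process_value ::
  "nat \<Rightarrow> (nat \<Rightarrow> real) \<Rightarrow> (nat \<Rightarrow> 'a \<Rightarrow> real^'d^'d) \<Rightarrow> real \<Rightarrow> 'a \<Rightarrow> real^'d^'d" where
  "simple_process_value n \<tau> \<xi> s \<omega> = (\<Sum>i<n. indicator {\<tau> i<..\<tau> (Suc i)} s *\<^sub>R \<xi> i \<omega>)"

definition simple_integral_process ::
  "(real \<Rightarrow> 'a \<Rightarrow> real^'d) \<Rightarrow> nat \<Rightarrow> (nat \<Rightarrow> real) \<Rightarrow> (nat \<Rightarrow> 'a \<Rightarrow> real^'d^'d) \<Rightarrow> real \<Rightarrow> 'a \<Rightarrow> real^'d" where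
  "simple_integral_process W n \<tau> \<xi> s \<omega> =
     (\<Sum>i<n. \<xi> i \<omega> *v (W (min s (\<tau> (Suc i))) \<omega> - W (min s (\<tau> i)) \<omega>))"

text \<open>The usual definition by localised approximation: \<open>I\<close> is a continuous adapted version of
  the integral of \<open>H\<close> against \<open>W\<close> if it is the limit, uniformly on \<open>{0..T}\<close> in probability, of
  the elementary integrals of simple processes converging to \<open>H\<close> in \<open>L\<^sup>2({0..T})\<close> in
  probability. This determines \<open>I\<close> up to indistinguishability.\<close>

definition is_stochastic_integral ::
  "'a measure \<Rightarrow> real \<Rightarrow> (real \<Rightarrow> 'a \<Rightarrow> real^'d) \<Rightarrow> (real \<Rightarrow> 'a \<Rightarrow> real^'d^'d) \<Rightarrow> (real \<Rightarrow> 'a \<Rightarrow> real^'d) \<Rightarrow> bool"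
where
  "is_stochastic_integral M T W H I \<longleftrightarrow>
     (\<forall>s\<in>{0..T}. I s \<in> borel_measurable (augmented_filtration M W s)) \<and>
     (AE \<omega> in M. continuous_on {0..T} (\<lambda>s. I s \<omega>)) \<and>
     (\<exists>n \<tau> \<xi>.
        (\<forall>k. simple_process T (augmented_filtration M W) (n k) (\<tau> k) (\<xi> k)) \<and>
        (\<forall>\<epsilon>>0. (\<lambda>k. measure (completion M) {\<omega>\<in>space M.
            ennreal \<epsilon> < (\<integral>\<^sup>+s\<in>{0..T}.
               ennreal ((norm (simple_process_value (n k) (\<tau> k) (\<xi> k) s \<omega> - H s \<omega>))\<^sup>2) \<partial>lborel)})
            \<longlonglongrightarrow> 0) \<and>
        (\<forall>\<epsilon>>0. (\<lambda>k. measure (completion M) {\<omega>\<in>space M.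
            \<exists>s\<in>{0..T}. \<epsilon> < norm (simple_integral_process W (n k) (\<tau> k) (\<xi> k) s \<omega> - I s \<omega>)})
            \<longlonglongrightarrow> 0))"


section \<open>Path space\<close>

text \<open>A path on \<open>{0..T}\<close> is represented by its extension to \<open>real\<close> that is constant to the left
  of \<open>0\<close> and to the right of \<open>T\<close>. This identifies \<open>path_space T\<close> isometrically with the continuous
  functions on \<open>{0..T}\<close> vanishing at \<open>0\<close> under the uniform norm. Functions \<open>\<phi>\<close> on path space are
  total functions on \<open>real \<Rightarrow>\<^sub>C (real^'d)\<close> of which only the values on \<open>path_space T\<close> matter.\<close>

definition path_space :: "real \<Rightarrow> (real \<Rightarrow>\<^sub>C (real^'d)) set" where
  "path_space T = {w. apply_bcontfun w 0 = 0 \<and> (\<forall>s. apply_bcontfun w s = apply_bcontfun w (clamp 0 T s))}"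

definition path_of :: "real \<Rightarrow> (real \<Rightarrow> real^'d) \<Rightarrow> (real \<Rightarrow>\<^sub>C (real^'d))" where
  "path_of T f = Bcontfun (\<lambda>s. f (clamp 0 T s))"

definition path_borel :: "real \<Rightarrow> (real \<Rightarrow>\<^sub>C (real^'d)) measure" where
  "path_borel T = restrict_space borel (path_space T)"

definition path_prob_measures :: "real \<Rightarrow> (real \<Rightarrow>\<^sub>C (real^'d)) measure set" where
  "path_prob_measures T = {\<mu>. prob_space \<mu> \<and> sets \<mu> = sets (path_borel T)}"

definition path_weak_topology :: "real \<Rightarrow> (real \<Rightarrow>\<^sub>C (real^'d)) measure topology" where
  "path_weak_topology T = topology_generated_by
     {{\<mu>\<in>path_prob_measures T. (\<integral>w. f w \<partial>\<mu>) \<in> U} | (f :: (real \<Rightarrow>\<^sub>C (real^'d)) \<Rightarrow> real) U.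
        continuous_on (path_space T) f \<and> bounded (f ` path_space T) \<and> open U}"

definition modulus_of_continuity :: "(ennreal \<Rightarrow> ennreal) \<Rightarrow> bool" where
  "modulus_of_continuity m \<longleftrightarrow> m 0 = 0 \<and> isCont m 0"

definition has_modulus ::
  "real \<Rightarrow> (ennreal \<Rightarrow> ennreal) \<Rightarrow> ((real \<Rightarrow>\<^sub>C (real^'d)) \<Rightarrow> real) \<Rightarrow> bool" where
  "has_modulus T m \<phi> \<longleftrightarrow>
     (\<forall>w\<in>path_space T. \<forall>w'\<in>path_space T. ennreal \<bar>\<phi> w - \<phi> w'\<bar> \<le> m (ennreal (norm (w - w'))))"


section \<open>Volatility uncertainty\<close>

type_synonym ('a, 'd) vol = "real \<Rightarrow> 'a \<Rightarrow> real^'d^'d"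

text \<open>\<open>Wt\<close> is the process \<open>\<integral>\<theta>\<^sup>1\<^sup>/\<^sup>2 dW\<close> on \<open>\<Omega> \<times> \<Theta>\<close>: for every \<open>\<theta>\<close> some version of the stochastic
  integral all of whose paths are continuous and start at \<open>0\<close>.\<close>

locale volatility_uncertainty = prob_space M
  for M :: "'a measure" and T :: real and W :: "real \<Rightarrow> 'a \<Rightarrow> real^'d"
    and \<Theta> :: "('a, 'd::finite) vol set" and Wt :: "real \<Rightarrow> 'a \<times> ('a, 'd) vol \<Rightarrow> real^'d" +
  assumes T_pos: "0 < T"
    and W_brownian: "brownian_motion M T W"
    and vol_progressive: "\<And>\<theta>. \<theta> \<in> \<Theta> \<Longrightarrow> progressively_measurable T (augmented_filtration M W) \<theta>"
    and vol_pos_definite: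
      "\<And>\<theta> s \<omega>. \<theta> \<in> \<Theta> \<Longrightarrow> s \<in> {0..T} \<Longrightarrow> \<omega> \<in> space M \<Longrightarrow> pos_definite (\<theta> s \<omega>)"
    and vol_integrable:
      "\<And>\<theta>. \<theta> \<in> \<Theta> \<Longrightarrow>
         AE \<omega> in M. (\<integral>\<^sup>+s\<in>{0..T}. ennreal ((norm (matrix_sqrt (\<theta> s \<omega>)))\<^sup>2) \<partial>lborel) < \<infinity>"
    and Wt_integral:
      "\<And>\<theta>. \<theta> \<in> \<Theta> \<Longrightarrow>
         is_stochastic_integral M T W (\<lambda>s \<omega>. matrix_sqrt (\<theta> s \<omega>)) (\<lambda>s \<omega>. Wt s (\<omega>, \<theta>))"
    and Wt_zero: "\<And>\<theta> \<omega>. \<theta> \<in> \<Theta> \<Longrightarrow> \<omega> \<in> space M \<Longrightarrow> Wt 0 (\<omega>, \<theta>) = 0"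
    and Wt_continuous:
      "\<And>\<theta> \<omega>. \<theta> \<in> \<Theta> \<Longrightarrow> \<omega> \<in> space M \<Longrightarrow> continuous_on {0..T} (\<lambda>s. Wt s (\<omega>, \<theta>))"

definition filtration_tilde ::
  "'a measure \<Rightarrow> ('a, 'd::finite) vol set \<Rightarrow> (real \<Rightarrow> 'a \<times> ('a, 'd) vol \<Rightarrow> real^'d) \<Rightarrow> real \<Rightarrow>
   ('a \<times> ('a, 'd) vol) measure" where
  "filtration_tilde M \<Theta> Wt t = generated_sigma (space M \<times> \<Theta>) {0..t} Wt"

definition P_vol :: "'a measure \<Rightarrow> ('a, 'd::finite) vol \<Rightarrow> ('a \<times> ('a, 'd) vol) set \<Rightarrow> ennreal" where
  "P_vol M \<theta> A = emeasure (completion M) {\<omega>\<in>space M. (\<omega>, \<theta>) \<in> A}"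

definition P_tilde :: "'a measure \<Rightarrow> ('a, 'd::finite) vol set \<Rightarrow> ('a \<times> ('a, 'd) vol) set \<Rightarrow> ennreal" where
  "P_tilde M \<Theta> A = (SUP \<theta>\<in>\<Theta>. P_vol M \<theta> A)"

definition polar ::
  "'a measure \<Rightarrow> real \<Rightarrow> ('a, 'd::finite) vol set \<Rightarrow> (real \<Rightarrow> 'a \<times> ('a, 'd) vol \<Rightarrow> real^'d) \<Rightarrow>
   ('a \<times> ('a, 'd) vol) set \<Rightarrow> bool" where
  "polar M T \<Theta> Wt A \<longleftrightarrow>
     A \<subseteq> space M \<times> \<Theta> \<and> (\<exists>B\<in>sets (filtration_tilde M \<Theta> Wt T). A \<subseteq> B \<and> P_tilde M \<Theta> B = 0)"

definition quasi_surely ::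
  "'a measure \<Rightarrow> real \<Rightarrow> ('a, 'd::finite) vol set \<Rightarrow> (real \<Rightarrow> 'a \<times> ('a, 'd) vol \<Rightarrow> real^'d) \<Rightarrow>
   ('a \<times> ('a, 'd) vol \<Rightarrow> bool) \<Rightarrow> bool" where
  "quasi_surely M T \<Theta> Wt Q \<longleftrightarrow> polar M T \<Theta> Wt {x\<in>space M \<times> \<Theta>. \<not> Q x}"

definition stopped_path ::
  "real \<Rightarrow> (real \<Rightarrow> 'a \<times> ('a, 'd::finite) vol \<Rightarrow> real^'d) \<Rightarrow> real \<Rightarrow> 'a \<times> ('a, 'd) vol \<Rightarrow>
   (real \<Rightarrow>\<^sub>C (real^'d))" where
  "stopped_path T Wt t x = path_of T (\<lambda>s. Wt (min s t) x)"

definition path_law ::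
  "'a measure \<Rightarrow> real \<Rightarrow> (real \<Rightarrow> 'a \<times> ('a, 'd::finite) vol \<Rightarrow> real^'d) \<Rightarrow> ('a, 'd) vol \<Rightarrow>
   (real \<Rightarrow>\<^sub>C (real^'d)) measure" where
  "path_law M T Wt \<theta> =
     distr (completion M) (path_borel T) (\<lambda>\<omega>. path_of T (\<lambda>s. Wt s (\<omega>, \<theta>)))"

text \<open>Elements of \<open>L\<^sup>0\<close> are represented by functions, and quasi-sure identification is made
  explicit wherever two random variables are compared.\<close>

definition C_mod ::
  "'a measure \<Rightarrow> real \<Rightarrow> ('a, 'd::finite) vol set \<Rightarrow> (real \<Rightarrow> 'a \<times> ('a, 'd) vol \<Rightarrow> real^'d) \<Rightarrow>
   (ennreal \<Rightarrow> ennreal) \<Rightarrow> real \<Rightarrow> ('a \<times> ('a, 'd) vol \<Rightarrow> real) set" where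
  "C_mod M T \<Theta> Wt m t =
     {X \<in> borel_measurable (filtration_tilde M \<Theta> Wt t).
        \<exists>\<phi>. has_modulus T m \<phi> \<and> quasi_surely M T \<Theta> Wt (\<lambda>x. X x = \<phi> (stopped_path T Wt t x))}"

text \<open>The infimum runs over representing functions \<open>\<phi>\<close> with modulus \<open>m\<close>; without this
  restriction one could change \<open>\<phi>\<close> arbitrarily on polar sets of paths. It is taken in the extended
  reals because it may be \<open>-\<infinity>\<close> at paths outside the support of the laws of the stopped process:
  \<open>m\<close> may take the value \<open>\<infinity>\<close>, and \<open>\<phi>\<close> is bounded below on that support only.\<close>

definition phi_star ::
  "'a measure \<Rightarrow> real \<Rightarrow> ('a, 'd::finite) vol set \<Rightarrow> (real \<Rightarrow> 'a \<times> ('a, 'd) vol \<Rightarrow> real^'d) \<Rightarrow>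
   (ennreal \<Rightarrow> ennreal) \<Rightarrow> real \<Rightarrow> ('a \<times> ('a, 'd) vol \<Rightarrow> real) set \<Rightarrow> (real \<Rightarrow>\<^sub>C (real^'d)) \<Rightarrow> ereal" where
  "phi_star M T \<Theta> Wt m t \<X> w =
     (INF \<phi>\<in>{\<phi>. has_modulus T m \<phi> \<and>
          (\<exists>X\<in>\<X>. quasi_surely M T \<Theta> Wt (\<lambda>x. X x = \<phi> (stopped_path T Wt t x)))}. ereal (\<phi> w))"

definition X_star ::
  "'a measure \<Rightarrow> real \<Rightarrow> ('a, 'd::finite) vol set \<Rightarrow> (real \<Rightarrow> 'a \<times> ('a, 'd) vol \<Rightarrow> real^'d) \<Rightarrow>
   (ennreal \<Rightarrow> ennreal) \<Rightarrow> real \<Rightarrow> ('a \<times> ('a, 'd) vol \<Rightarrow> real) set \<Rightarrow> 'a \<times> ('a, 'd) vol \<Rightarrow> ereal" where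
  "X_star M T \<Theta> Wt m t \<X> x = phi_star M T \<Theta> Wt m t \<X> (stopped_path T Wt t x)"

end

theory Submission
  imports Defs
begin

text \<open>
  Everything rests on the separability of path space. All representing functions share the modulus
  \<open>m\<close> and are therefore continuous, so the Lindelof property yields a single sequence \<open>f n\<close> of
  them whose infimum equals \<open>phi_star\<close> at every path (\<open>countable_subfamily_same_INF\<close> and
  \<open>path_space_small_cells\<close>). Let \<open>X n\<close> be elements of the given family represented by \<open>f n\<close>.
  For each volatility, countably many almost sure identities combine to show that the infimum of
  the \<open>X n\<close> is \<open>X_star\<close> almost surely. The sequence does not depend on the volatility, so it also
  serves for the convergence in capacity.

  The infimum \<open>phi_star\<close> may take the value \<open>-\<infinity>\<close>. The common modulus makes the set of
  paths where it is finite open and closed (\<open>continuous_on_indicator_INF_finite\<close>), and replacing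
  \<open>-\<infinity>\<close> by \<open>0\<close> gives a function \<open>\<psi>\<close> that still has modulus \<open>m\<close> (\<open>has_modulus_INF\<close>). The lower bound
  on the family shows that the stopped path lies in the set of finiteness almost surely under every
  volatility, so \<open>\<psi>\<close> represents \<open>X_star\<close> quasi-surely.

  For the convergence in capacity, the minimum of \<open>f 0, \<dots>, f n\<close> decreases to \<open>\<psi>\<close> on the set of
  finiteness. Truncating the excess over \<open>\<psi>\<close> and evaluating it at the stopped path gives bounded
  continuous functions on path space whose integrals are continuous in the law, decrease in \<open>n\<close> and
  tend to \<open>0\<close> at every law under which the stopped path almost surely lies in the set of finiteness.
  As that set is open and closed, the weak limits of the path laws inherit this property, and Dini's
  theorem on the compact closure of the laws gives convergence to \<open>0\<close> uniformly over the volatilities (\<open>Dini_weakly_compact\<close>). Markov's inequality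
  turns this into convergence in capacity (\<open>MIN_tendsto_in_capacity\<close>).
\<close>

section \<open>Countable subfamilies with the same infimum\<close>

text \<open>Separability is expressed by countable covers with cells of arbitrarily small
  diameter. A cell around \<open>x\<close> that is small compared with a ball around \<open>x\<close> inside some \<open>U i\<close>
  lies in that \<open>U i\<close>, so choosing one index for every cell that fits into some \<open>U i\<close> loses no
  point. The space is a subset of a metric type because path space is separable while the type
  of all bounded continuous functions on the line is not.\<close>

lemma Lindelof_of_small_cells:
  fixes E :: "'b::metric_space set"
  assumes cells: "\<And>e. 0 < e \<Longrightarrow>
      \<exists>\<C>. countable \<C> \<and> E \<subseteq> \<Union>\<C> \<and> (\<forall>A\<in>\<C>. \<forall>x\<in>A. \<forall>y\<in>A. dist x y < e)"
    and op: "\<And>i. i \<in> I \<Longrightarrow> openin (top_of_set E) (U i)"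
  obtains J where "countable J" "J \<subseteq> I" "(\<Union>i\<in>J. U i) = (\<Union>i\<in>I. U i)"
proof -
  have "\<forall>n::nat. \<exists>\<C>. countable \<C> \<and> E \<subseteq> \<Union>\<C> \<and> (\<forall>A\<in>\<C>. \<forall>x\<in>A. \<forall>y\<in>A. dist x y < inverse (Suc n))"
    using cells by simp
  then obtain \<C> where "\<forall>n::nat. countable (\<C> n) \<and> E \<subseteq> \<Union>(\<C> n) \<and>
      (\<forall>A\<in>\<C> n. \<forall>x\<in>A. \<forall>y\<in>A. dist x y < inverse (Suc n))"
    unfolding choice_iff by blast
  then have C: "\<And>n::nat. countable (\<C> n)" "\<And>n. E \<subseteq> \<Union>(\<C> n)"
      "\<And>n A x y. A \<in> \<C> n \<Longrightarrow> x \<in> A \<Longrightarrow> y \<in> A \<Longrightarrow> dist x y < inverse (Suc n)"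
    by simp_all
  define \<D> where "\<D> = {A \<in> (\<Union>n. \<C> n). \<exists>i\<in>I. A \<inter> E \<subseteq> U i}"
  have "countable \<D>"
    unfolding \<D>_def by (rule countable_subset[of _ "\<Union>n. \<C> n", rotated]) (auto intro: C(1))
  have "\<forall>A\<in>\<D>. \<exists>i. i \<in> I \<and> A \<inter> E \<subseteq> U i"
    by (auto simp: \<D>_def)
  then obtain sel where sel: "\<And>A. A \<in> \<D> \<Longrightarrow> sel A \<in> I \<and> A \<inter> E \<subseteq> U (sel A)"
    by metis
  show thesis
  proof
    show "countable (sel ` \<D>)" using \<open>countable \<D>\<close> by simp
    show "sel ` \<D> \<subseteq> I" using sel by auto
    show "(\<Union>i\<in>sel ` \<D>. U i) = (\<Union>i\<in>I. U i)"
    proof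
      show "(\<Union>i\<in>I. U i) \<subseteq> (\<Union>i\<in>sel ` \<D>. U i)"
      proof
        fix x assume "x \<in> (\<Union>i\<in>I. U i)"
        then obtain i where i: "i \<in> I" "x \<in> U i" by auto
        then obtain e where e: "0 < e" "ball x e \<inter> E \<subseteq> U i" and x: "x \<in> E"
          using op[OF i(1)] i(2) unfolding openin_contains_ball by blast
        obtain n where n: "inverse (real (Suc n)) < e"
          using reals_Archimedean[OF e(1)] by auto
        obtain A where A: "A \<in> \<C> n" "x \<in> A" using C(2)[of n] x by auto
        have "A \<inter> E \<subseteq> U i"
          using C(3)[OF A(1) A(2)] n e(2) by (force simp: mem_ball)
        then have "A \<in> \<D>" using A i(1) by (auto simp: \<D>_def)
        then show "x \<in> (\<Union>i\<in>sel ` \<D>. U i)" using sel[of A] A(2) x by auto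
      qed
    qed (use sel in auto)
  qed
qed

text \<open>For a fixed rational level \<open>q\<close> the sets where some member lies below \<open>q\<close> are open, so by
  the Lindelof property countably many members already cover their union; collecting these members
  over all \<open>q\<close> leaves no room for a gap between the two infima.\<close>

lemma countable_subfamily_same_INF:
  fixes E :: "'b::metric_space set" and \<Phi> :: "('b \<Rightarrow> real) set"
  assumes cells: "\<And>e. 0 < e \<Longrightarrow>
      \<exists>\<C>. countable \<C> \<and> E \<subseteq> \<Union>\<C> \<and> (\<forall>A\<in>\<C>. \<forall>x\<in>A. \<forall>y\<in>A. dist x y < e)"
    and cont: "\<And>\<phi>. \<phi> \<in> \<Phi> \<Longrightarrow> continuous_on E \<phi>" and ne: "\<Phi> \<noteq> {}"
  obtains f :: "nat \<Rightarrow> 'b \<Rightarrow> real" where "range f \<subseteq> \<Phi>"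
    "\<And>w. w \<in> E \<Longrightarrow> (INF n. ereal (f n w)) = (INF \<phi>\<in>\<Phi>. ereal (\<phi> w))"
proof -
  define U where "U q \<phi> = {w\<in>E. \<phi> w < real_of_rat q}" for q and \<phi> :: "'b \<Rightarrow> real"
  have "\<exists>J. countable J \<and> J \<subseteq> \<Phi> \<and> \<Union>(U q ` J) = \<Union>(U q ` \<Phi>)" for q
  proof -
    have "openin (top_of_set E) (U q \<phi>)" if "\<phi> \<in> \<Phi>" for \<phi>
    proof -
      have "U q \<phi> = E \<inter> \<phi> -` {..<real_of_rat q}" by (auto simp: U_def)
      then show ?thesis using continuous_openin_preimage_gen[OF cont[OF that], of "{..<real_of_rat q}"] by simp
    qed
    from Lindelof_of_small_cells[where U="U q", OF cells this]
    show ?thesis by (metis (no_types, lifting))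
  qed
  then have "\<forall>q. \<exists>J. countable J \<and> J \<subseteq> \<Phi> \<and> \<Union>(U q ` J) = \<Union>(U q ` \<Phi>)" ..
  from choice[OF this] obtain J
    where J: "\<forall>q. countable (J q) \<and> J q \<subseteq> \<Phi> \<and> \<Union>(U q ` J q) = \<Union>(U q ` \<Phi>)" ..
  obtain \<phi>0 where \<phi>0: "\<phi>0 \<in> \<Phi>" using ne by auto
  define K where "K = insert \<phi>0 (\<Union>q. J q)"
  have K: "countable K" "K \<noteq> {}" "K \<subseteq> \<Phi>" using J \<phi>0 by (auto simp: K_def)
  have ran: "range (from_nat_into K) = K" using K by (simp add: range_from_nat_into)
  show thesis
  proof
    show "range (from_nat_into K) \<subseteq> \<Phi>" using ran K by simp
    fix w assume w: "w \<in> E"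
    have "(INF n. ereal (from_nat_into K n w)) = (INF \<phi>\<in>range (from_nat_into K). ereal (\<phi> w))"
      by (simp add: image_image)
    also have "\<dots> = (INF \<phi>\<in>K. ereal (\<phi> w))" by (simp only: ran)
    also have "\<dots> = (INF \<phi>\<in>\<Phi>. ereal (\<phi> w))"
    proof (rule antisym)
      show "(INF \<phi>\<in>\<Phi>. ereal (\<phi> w)) \<le> (INF \<phi>\<in>K. ereal (\<phi> w))"
        using K by (intro INF_superset_mono) auto
      show "(INF \<phi>\<in>K. ereal (\<phi> w)) \<le> (INF \<phi>\<in>\<Phi>. ereal (\<phi> w))"
      proof (rule INF_greatest, rule ccontr)
        fix \<phi> assume \<phi>: "\<phi> \<in> \<Phi>" and "\<not> (INF \<phi>\<in>K. ereal (\<phi> w)) \<le> ereal (\<phi> w)"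
        then obtain q where q: "ereal (\<phi> w) < real_of_rat q" "real_of_rat q < (INF \<phi>\<in>K. ereal (\<phi> w))"
          using ereal_dense3[of "ereal (\<phi> w)"] by (auto simp: not_le)
        have "w \<in> \<Union>(U q ` \<Phi>)" using \<phi> q(1) w by (auto simp: U_def)
        then have "w \<in> \<Union>(U q ` J q)" using J by simp
        then obtain \<phi>' where "\<phi>' \<in> K" "\<phi>' w < real_of_rat q" by (auto simp: K_def U_def)
        then have "(INF \<phi>\<in>K. ereal (\<phi> w)) \<le> ereal (real_of_rat q)"
          by (intro INF_lower2[of \<phi>']) auto
        then show False using q by (simp add: not_le[symmetric])
      qed
    qed
    finally show "(INF n. ereal (from_nat_into K n w)) = (INF \<phi>\<in>\<Phi>. ereal (\<phi> w))" .
  qed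
qed

section \<open>Path space\<close>

lemma clamp_real: "a \<le> b \<Longrightarrow> clamp a b s = max a (min b s)" for a b s :: real
  unfolding clamp_def by (simp only: Basis_real_def) auto

lemma apply_path_of:
  assumes "0 \<le> T" "continuous_on {0..T} f"
  shows "apply_bcontfun (path_of T f) s = f (clamp 0 T s)"
proof -
  have "continuous_on UNIV (\<lambda>s. f (clamp 0 T s))"
    using assms by (intro clamp_continuous_on) simp
  moreover have "bounded (range (\<lambda>s. f (clamp 0 T s)))"
    using assms by (intro clamp_bounded compact_imp_bounded compact_continuous_image) auto
  ultimately show ?thesis by (simp add: path_of_def Bcontfun_inverse bcontfun_def)
qed

lemma path_of_in_path_space:
  assumes "0 \<le> T" "continuous_on {0..T} f" "f 0 = 0"
  shows "path_of T f \<in> path_space T"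
  using assms by (auto simp: path_space_def apply_path_of clamp_real)

text \<open>Cells are indexed by a mesh and by a list of values from a countable dense set: a cell
  consists of the paths that stay near the listed value on both sides of each grid point. Uniform
  continuity puts every path into some cell.\<close>

lemma path_space_small_cells:
  assumes T: "0 < T" and e: "0 < e"
  shows "\<exists>\<C>. countable \<C> \<and> (path_space T :: (real \<Rightarrow>\<^sub>C (real^'d)) set) \<subseteq> \<Union>\<C> \<and>
    (\<forall>A\<in>\<C>. \<forall>v\<in>A. \<forall>w\<in>A. dist v w < e)"
proof -
  obtain D :: "(real^'d) set" where D: "countable D" "\<And>X. open X \<Longrightarrow> X \<noteq> {} \<Longrightarrow> \<exists>d\<in>D. d \<in> X"
    using countable_dense_setE by blast
  define cell where "cell = (\<lambda>(n::nat, q). {w\<in>(path_space T :: (real \<Rightarrow>\<^sub>C (real^'d)) set).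
      \<forall>k\<le>n. \<forall>s\<in>{0..T}. \<bar>s - real k * T / n\<bar> \<le> T / n \<longrightarrow> dist (apply_bcontfun w s) (q ! k) < e / 3})"
  define \<C> where "\<C> = cell ` ({0<..} \<times> lists D)"
  \<comment> \<open>Every time in the interval is within one mesh width of its left grid point.\<close>
  have grid: "\<exists>k\<le>n. \<bar>s - real k * T / n\<bar> \<le> T / n" if "0 < n" "s \<in> {0..T}" for n :: nat and s
  proof (intro exI conjI)
    let ?k = "nat \<lfloor>s * n / T\<rfloor>"
    have k: "real ?k \<le> s * n / T" "s * n / T < real ?k + 1"
      using that T by auto
    have "s * n / T \<le> n" using that T by (simp add: field_simps)
    then show "?k \<le> n" using k by linarith
    have "real ?k * T \<le> s * n" "s * n < (real ?k + 1) * T"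
      using k T by (auto simp: field_simps)
    then have "real ?k * T / n \<le> s" "s < (real ?k + 1) * T / n"
      using that(1) by (auto simp: field_simps)
    moreover have "(real ?k + 1) * T / n = real ?k * T / n + T / n"
      by (simp add: add_divide_distrib distrib_right)
    ultimately show "\<bar>s - real ?k * T / n\<bar> \<le> T / n" by linarith
  qed
  have "dist v w < e" if vw: "v \<in> cell (n, q)" "w \<in> cell (n, q)" and n: "0 < n" for v w n q
  proof -
    have "dist (apply_bcontfun v s) (apply_bcontfun w s) \<le> 2 * e / 3" for s
      \<comment> \<open>A non-strict bound below \<open>e\<close>, since passing to the supremum over \<open>s\<close> loses strictness.\<close>
    proof -
      let ?s = "clamp 0 T s"
      have s: "?s \<in> {0..T}" using T by (simp add: clamp_real)
      obtain k where k: "k \<le> n" "\<bar>?s - real k * T / n\<bar> \<le> T / n" using grid[OF n s] by blast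
      then have "dist (apply_bcontfun v ?s) (q ! k) < e / 3" "dist (apply_bcontfun w ?s) (q ! k) < e / 3"
        using vw s by (auto simp: cell_def)
      then have "dist (apply_bcontfun v ?s) (apply_bcontfun w ?s) < 2 * e / 3"
        using dist_triangle2[of "apply_bcontfun v ?s" "apply_bcontfun w ?s" "q ! k"] by linarith
      moreover have "apply_bcontfun v s = apply_bcontfun v ?s" "apply_bcontfun w s = apply_bcontfun w ?s"
        using vw by (auto simp: cell_def path_space_def)
      ultimately show ?thesis by simp
    qed
    from dist_bound[OF this] show ?thesis using e by simp
  qed
  then have small: "\<forall>A\<in>\<C>. \<forall>v\<in>A. \<forall>w\<in>A. dist v w < e"
    by (auto simp: \<C>_def)
  have "path_space T \<subseteq> \<Union>\<C>"
  proof
    fix w :: "real \<Rightarrow>\<^sub>C (real^'d)" assume w: "w \<in> path_space T"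
    have "uniformly_continuous_on {0..T} (apply_bcontfun w)"
      by (intro compact_uniformly_continuous) auto
    then obtain d where d: "0 < d"
        "\<And>s u. s \<in> {0..T} \<Longrightarrow> u \<in> {0..T} \<Longrightarrow> dist u s < d \<Longrightarrow> dist (apply_bcontfun w u) (apply_bcontfun w s) < e / 6"
      using e unfolding uniformly_continuous_on_def by (metis zero_less_divide_iff zero_less_numeral)
    obtain n :: nat where n: "T / d < n" using reals_Archimedean2 by blast
    have n0: "0 < n" "T / n < d"
    proof -
      have "0 < T / d" using T d by simp
      with n have "0 < real n" by linarith
      then show "0 < n" by simp
      then show "T / n < d" using n d(1) by (simp add: field_simps)
    qed
    have "\<exists>x\<in>D. dist (apply_bcontfun w (real k * T / n)) x < e / 6" for k
      using D(2)[of "ball (apply_bcontfun w (real k * T / n)) (e / 6)"] e by auto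
    then obtain x where x: "\<And>k. x k \<in> D" "\<And>k. dist (apply_bcontfun w (real k * T / n)) (x k) < e / 6"
      by metis
    \<comment> \<open>The grid has the \<open>n + 1\<close> points \<open>0, T / n, \<dots>, T\<close>.\<close>
    let ?q = "map x [0..<Suc n]"
    have "w \<in> cell (n, ?q)"
      unfolding cell_def prod.case
    proof (intro CollectI conjI w allI impI ballI)
      fix k s assume k: "k \<le> n" and s: "s \<in> {0..T}" "\<bar>s - real k * T / real n\<bar> \<le> T / real n"
      have "real k * T / n \<le> T"
        using k n0 T by (simp add: divide_le_eq mult.commute mult_left_mono)
      then have "dist (apply_bcontfun w s) (apply_bcontfun w (real k * T / n)) < e / 6"
        using s n0 T by (intro d(2)) (auto simp: dist_real_def)
      with x(2)[of k] have "dist (apply_bcontfun w s) (x k) < e / 3"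
        using dist_triangle[of "apply_bcontfun w s" "x k" "apply_bcontfun w (real k * T / n)"] by linarith
      then show "dist (apply_bcontfun w s) (map x [0..<Suc n] ! k) < e / 3"
        using k by (simp del: upt_Suc)
    qed
    moreover have "?q \<in> lists D" using x by auto
    ultimately show "w \<in> \<Union>\<C>"
      using n0(1) unfolding \<C>_def by (intro UnionI[of "cell (n, ?q)"] imageI) simp_all
  qed
  moreover have "countable \<C>" using D(1) by (auto simp: \<C>_def)
  ultimately show ?thesis using small by blast
qed

text \<open>Path space being separable, an open set is a countable union of closed balls, and
  membership in a closed ball is a countable condition on coordinates; hence the Borel sets of
  path space are generated by the coordinates.\<close>

lemma measurable_path_borelI:
  fixes f :: "'b \<Rightarrow> (real \<Rightarrow>\<^sub>C (real^'d))"
  assumes T: "0 < T" and f: "f \<in> space N \<rightarrow> path_space T"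
    and coord: "\<And>s. (\<lambda>x. apply_bcontfun (f x) s) \<in> borel_measurable N"
  shows "f \<in> measurable N (path_borel T)"
  unfolding path_borel_def
proof (rule measurable_restrict_space2[OF f], rule borel_measurableI)
  let ?E = "path_space T :: (real \<Rightarrow>\<^sub>C (real^'d)) set"
  fix S :: "(real \<Rightarrow>\<^sub>C (real^'d)) set" assume S: "open S"
  define I where "I = {(w, r). w \<in> ?E \<and> 0 < r \<and> cball w r \<subseteq> S}"
  have "openin (top_of_set ?E) (?E \<inter> ball (fst i) (snd i))" for i by (simp add: openin_open_Int)
  from Lindelof_of_small_cells[where I=I and U="\<lambda>i. ?E \<inter> ball (fst i) (snd i)",
      OF path_space_small_cells[OF T] this]
  obtain J where J: "countable J" "J \<subseteq> I"
      "(\<Union>i\<in>J. ?E \<inter> ball (fst i) (snd i)) = (\<Union>i\<in>I. ?E \<inter> ball (fst i) (snd i))"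
    by blast
  have ball: "{x\<in>space N. f x \<in> cball w r} \<in> sets N" for w r
  proof -
    \<comment> \<open>The uniform distance is controlled at rational times.\<close>
    have "f x \<in> cball w r \<longleftrightarrow>
        (\<forall>q::rat. dist (apply_bcontfun w (of_rat q)) (apply_bcontfun (f x) (of_rat q)) \<le> r)" for x
    proof
      assume *: "\<forall>q::rat. dist (apply_bcontfun w (of_rat q)) (apply_bcontfun (f x) (of_rat q)) \<le> r"
      let ?S = "{s. dist (apply_bcontfun w s) (apply_bcontfun (f x) s) \<le> r}"
      have "closed ?S"
        by (intro closed_Collect_le continuous_intros continuous_on_dist) auto
      moreover have "\<rat> \<subseteq> ?S" using * by (auto simp: Rats_def)
      ultimately have "closure \<rat> \<subseteq> ?S" by (rule closure_minimal[rotated])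
      then show "f x \<in> cball w r"
        by (auto simp: Rats_closure_real intro!: dist_bound)
    qed (auto intro: order_trans[OF dist_bounded])
    then have "{x\<in>space N. f x \<in> cball w r} =
        {x\<in>space N. \<forall>q::rat. dist (apply_bcontfun w (of_rat q)) (apply_bcontfun (f x) (of_rat q)) \<le> r}"
      by auto
    also have "\<dots> \<in> sets N" using coord by measurable
    finally show ?thesis .
  qed
  have "f -` S \<inter> space N = (\<Union>i\<in>J. {x\<in>space N. f x \<in> cball (fst i) (snd i)})"
  proof
    show "f -` S \<inter> space N \<subseteq> (\<Union>i\<in>J. {x\<in>space N. f x \<in> cball (fst i) (snd i)})"
    proof
      fix x assume x: "x \<in> f -` S \<inter> space N"
      then obtain r where "0 < r" "cball (f x) r \<subseteq> S" using S open_contains_cball by blast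
      moreover have fx: "f x \<in> ?E" using f x by auto
      ultimately have "f x \<in> (\<Union>i\<in>I. ?E \<inter> ball (fst i) (snd i))"
        by (intro UN_I[of "(f x, r)"]) (auto simp: I_def)
      then have "f x \<in> (\<Union>i\<in>J. ?E \<inter> ball (fst i) (snd i))" using J(3) by simp
      then show "x \<in> (\<Union>i\<in>J. {x\<in>space N. f x \<in> cball (fst i) (snd i)})"
        using x by (auto 4 4 intro: less_imp_le)
    qed
  qed (use J(2) in \<open>force simp: I_def\<close>)
  then show "f -` S \<inter> space N \<in> sets N" using ball J(1) by auto
qed

section \<open>Infima of functions with a common modulus of continuity\<close>

lemma modulus_small_near_0:
  assumes "modulus_of_continuity m" "0 < e"
  obtains \<delta> :: real where "0 < \<delta>" "\<And>r. 0 \<le> r \<Longrightarrow> r < \<delta> \<Longrightarrow> m (ennreal r) < e"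
proof -
  have "isCont ennreal 0"
    unfolding isCont_def by (intro tendsto_ennrealI tendsto_ident_at)
  moreover have "isCont m (ennreal 0)" using assms(1) by (simp add: modulus_of_continuity_def)
  ultimately have "isCont (\<lambda>r. m (ennreal r)) 0" by (rule isCont_o2)
  then have "((\<lambda>r. m (ennreal r)) \<longlongrightarrow> m (ennreal 0)) (nhds 0)"
    using tendsto_at_iff_tendsto_nhds[of "\<lambda>r. m (ennreal r)" 0] by (simp add: isCont_def)
  then have "eventually (\<lambda>r. m (ennreal r) < e) (nhds 0)"
    using assms by (rule_tac order_tendstoD(2)) (simp_all add: modulus_of_continuity_def)
  then show thesis
    using that by (auto simp: eventually_nhds_metric dist_real_def)
qed

lemma has_modulus_continuous_on:
  fixes \<phi> :: "(real \<Rightarrow>\<^sub>C (real^'d)) \<Rightarrow> real"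
  assumes m: "modulus_of_continuity m" and \<phi>: "has_modulus T m \<phi>"
  shows "continuous_on (path_space T) \<phi>"
  unfolding continuous_on_iff
proof (intro ballI allI impI)
  fix w :: "real \<Rightarrow>\<^sub>C (real^'d)" and e :: real assume w: "w \<in> path_space T" and e: "0 < e"
  obtain \<delta> where \<delta>: "0 < \<delta>" "\<And>r. 0 \<le> r \<Longrightarrow> r < \<delta> \<Longrightarrow> m (ennreal r) < ennreal e"
    using modulus_small_near_0[OF m, of "ennreal e"] e by auto
  have "dist (\<phi> v) (\<phi> w) < e" if v: "v \<in> path_space T" "dist v w < \<delta>" for v
  proof -
    have "ennreal \<bar>\<phi> v - \<phi> w\<bar> \<le> m (ennreal (norm (v - w)))"
      using \<phi> v w by (auto simp: has_modulus_def)
    also have "\<dots> < ennreal e" using \<delta> v by (auto simp: dist_norm)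
    finally show ?thesis by (simp add: dist_real_def ennreal_less_iff)
  qed
  then show "\<exists>d>0. \<forall>v\<in>path_space T. dist v w < d \<longrightarrow> dist (\<phi> v) (\<phi> w) < e"
    using \<delta>(1) by blast
qed

text \<open>A bound on the modulus at the distance of \<open>v\<close> and \<open>w\<close> holds simultaneously for all
  members of the family, hence passes to the infimum, in the extended reals.\<close>

lemma INF_le_INF_plus_modulus:
  fixes \<Phi> :: "((real \<Rightarrow>\<^sub>C (real^'d)) \<Rightarrow> real) set"
  assumes \<Phi>: "\<And>\<phi>. \<phi> \<in> \<Phi> \<Longrightarrow> has_modulus T m \<phi>"
    and w: "v \<in> path_space T" "w \<in> path_space T" and r: "m (ennreal (norm (v - w))) \<le> ennreal r" "0 \<le> r"
  shows "(INF \<phi>\<in>\<Phi>. ereal (\<phi> v)) \<le> (INF \<phi>\<in>\<Phi>. ereal (\<phi> w)) + ereal r"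
proof -
  have "(INF \<phi>\<in>\<Phi>. ereal (\<phi> v)) - ereal r \<le> (INF \<phi>\<in>\<Phi>. ereal (\<phi> w))"
  proof (rule INF_greatest)
    fix \<phi> assume \<phi>: "\<phi> \<in> \<Phi>"
    have "ennreal \<bar>\<phi> v - \<phi> w\<bar> \<le> ennreal r"
      using \<Phi>[OF \<phi>] w r(1) unfolding has_modulus_def by (meson order_trans)
    then have "\<phi> v \<le> \<phi> w + r" using r(2) by (simp add: ennreal_le_iff abs_le_iff)
    then have "(INF \<phi>\<in>\<Phi>. ereal (\<phi> v)) \<le> ereal (\<phi> w) + ereal r"
      by (intro INF_lower2[OF \<phi>]) simp
    then show "(INF \<phi>\<in>\<Phi>. ereal (\<phi> v)) - ereal r \<le> ereal (\<phi> w)"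
      by (simp add: ereal_minus_le)
  qed
  then show ?thesis by (simp add: ereal_minus_le)
qed

lemma INF_finite_of_near:
  fixes \<Phi> :: "((real \<Rightarrow>\<^sub>C (real^'d)) \<Rightarrow> real) set"
  assumes "\<And>\<phi>. \<phi> \<in> \<Phi> \<Longrightarrow> has_modulus T m \<phi>"
    and "v \<in> path_space T" "w \<in> path_space T" and "m (ennreal (norm (v - w))) < \<infinity>"
    and "(INF \<phi>\<in>\<Phi>. ereal (\<phi> v)) \<noteq> -\<infinity>"
  shows "(INF \<phi>\<in>\<Phi>. ereal (\<phi> w)) \<noteq> -\<infinity>"
proof
  assume inf: "(INF \<phi>\<in>\<Phi>. ereal (\<phi> w)) = -\<infinity>"
  obtain r where r: "0 \<le> r" "m (ennreal (norm (v - w))) = ennreal r"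
    using assms(4) by (cases "m (ennreal (norm (v - w)))") auto
  have "(INF \<phi>\<in>\<Phi>. ereal (\<phi> v)) \<le> (INF \<phi>\<in>\<Phi>. ereal (\<phi> w)) + ereal r"
    using r by (intro INF_le_INF_plus_modulus[where T=T and m=m] assms) auto
  then show False using assms(5) inf by simp
qed

text \<open>At points where the infimum is \<open>-\<infinity>\<close>, \<open>real_of_ereal\<close> returns \<open>0\<close>. This arbitrary value
  does not destroy the modulus: the infimum can be finite at \<open>v\<close> and \<open>-\<infinity>\<close> at \<open>w\<close> only if the modulus
  at the distance of \<open>v\<close> and \<open>w\<close> is \<open>\<infinity>\<close>, so that nothing has to be shown there.\<close>

lemma has_modulus_INF:
  fixes \<Phi> :: "((real \<Rightarrow>\<^sub>C (real^'d)) \<Rightarrow> real) set"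
  assumes \<Phi>: "\<And>\<phi>. \<phi> \<in> \<Phi> \<Longrightarrow> has_modulus T m \<phi>" and ne: "\<Phi> \<noteq> {}"
  shows "has_modulus T m (\<lambda>w. real_of_ereal (INF \<phi>\<in>\<Phi>. ereal (\<phi> w)))"
  unfolding has_modulus_def
proof (intro ballI)
  fix v w :: "real \<Rightarrow>\<^sub>C (real^'d)" assume vw: "v \<in> path_space T" "w \<in> path_space T"
  let ?I = "\<lambda>w. INF \<phi>\<in>\<Phi>. ereal (\<phi> w)"
  have fin: "?I u \<noteq> \<infinity>" for u
  proof -
    obtain \<phi> where "\<phi> \<in> \<Phi>" using ne by auto
    then have "?I u \<le> ereal (\<phi> u)" by (rule INF_lower)
    then show ?thesis by auto
  qed
  show "ennreal \<bar>real_of_ereal (?I v) - real_of_ereal (?I w)\<bar> \<le> m (ennreal (norm (v - w)))"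
  proof (cases "m (ennreal (norm (v - w)))")
    case (real r)
    have wv: "m (ennreal (norm (w - v))) = ennreal r" using real by (simp add: norm_minus_commute)
    have "?I v \<le> ?I w + ereal r" "?I w \<le> ?I v + ereal r"
      using INF_le_INF_plus_modulus[OF \<Phi>, of _ v w r] INF_le_INF_plus_modulus[OF \<Phi>, of _ w v r] vw real wv
      by auto
    then have "\<bar>real_of_ereal (?I v) - real_of_ereal (?I w)\<bar> \<le> r"
      using fin[of v] fin[of w] real(1) by (cases "?I v"; cases "?I w") auto
    then show ?thesis using real by (simp add: ennreal_leI)
  qed simp
qed

text \<open>Paths so close that the modulus at their distance is finite have infima that are either
  both finite or both \<open>-\<infinity>\<close>. The set of finiteness is thus open and closed in path space, which makes
  its measure a weakly continuous function of the law.\<close>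

lemma continuous_on_indicator_INF_finite:
  fixes \<Phi> :: "((real \<Rightarrow>\<^sub>C (real^'d)) \<Rightarrow> real) set"
  assumes m: "modulus_of_continuity m" and \<Phi>: "\<And>\<phi>. \<phi> \<in> \<Phi> \<Longrightarrow> has_modulus T m \<phi>"
  shows "continuous_on (path_space T) (indicator {w. (INF \<phi>\<in>\<Phi>. ereal (\<phi> w)) \<noteq> -\<infinity>} :: _ \<Rightarrow> real)"
  unfolding continuous_on_iff
proof (intro ballI allI impI)
  fix w :: "real \<Rightarrow>\<^sub>C (real^'d)" and e :: real assume w: "w \<in> path_space T" and e: "0 < e"
  let ?G = "{w. (INF \<phi>\<in>\<Phi>. ereal (\<phi> w)) \<noteq> -\<infinity>}"
  obtain \<delta> where \<delta>: "0 < \<delta>" "\<And>r. 0 \<le> r \<Longrightarrow> r < \<delta> \<Longrightarrow> m (ennreal r) < \<infinity>"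
    using modulus_small_near_0[OF m, of \<infinity>] by auto
  have "v \<in> ?G \<longleftrightarrow> w \<in> ?G" if v: "v \<in> path_space T" "dist v w < \<delta>" for v
  proof -
    have "m (ennreal (norm (v - w))) < \<infinity>" "m (ennreal (norm (w - v))) < \<infinity>"
      using \<delta>(2) v(2) by (auto simp: dist_norm norm_minus_commute)
    then show ?thesis using INF_finite_of_near[OF \<Phi>] v(1) w by blast
  qed
  then show "\<exists>d>0. \<forall>v\<in>path_space T. dist v w < d \<longrightarrow>
      dist (indicator ?G v :: real) (indicator ?G w) < e"
    using \<delta>(1) e by (auto simp: indicator_def intro!: exI[of _ \<delta>])
qed

section \<open>Weakly compact families of laws\<close>

lemma openin_path_weak_topology:
  fixes f :: "(real \<Rightarrow>\<^sub>C (real^'d)) \<Rightarrow> real"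
  assumes "continuous_on (path_space T) f" "bounded (f ` path_space T)" "open U"
  shows "openin (path_weak_topology T) {\<mu>\<in>path_prob_measures T. (\<integral>w. f w \<partial>\<mu>) \<in> U}"
  unfolding path_weak_topology_def using assms by (intro topology_generated_by_Basis) blast

lemma topspace_path_weak_topology: "topspace (path_weak_topology T) = path_prob_measures T"
proof -
  have "path_prob_measures T = {\<mu>\<in>path_prob_measures T. (\<integral>w. (0::real) \<partial>\<mu>) \<in> UNIV}" by simp
  also have "openin (path_weak_topology T) \<dots>"
    by (intro openin_path_weak_topology) (auto intro!: boundedI[of _ 0])
  finally have "openin (path_weak_topology T) (path_prob_measures T)" .
  moreover have "topspace (path_weak_topology T) \<subseteq> path_prob_measures T"
    unfolding path_weak_topology_def by auto
  ultimately show ?thesis by (meson openin_subset subset_antisym)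
qed

lemma space_path_prob_measure: "\<mu> \<in> path_prob_measures T \<Longrightarrow> space \<mu> = path_space T"
  using sets_eq_imp_space_eq[of \<mu> "path_borel T"] by (auto simp: path_prob_measures_def path_borel_def space_restrict_space)

lemma path_prob_measure_borel:
  fixes f :: "(real \<Rightarrow>\<^sub>C (real^'d)) \<Rightarrow> real"
  assumes "\<mu> \<in> path_prob_measures T" "continuous_on (path_space T) f"
  shows "f \<in> borel_measurable \<mu>"
proof -
  have "sets \<mu> = sets (path_borel T)" using assms by (simp add: path_prob_measures_def)
  moreover have "f \<in> borel_measurable (path_borel T)"
    unfolding path_borel_def by (rule borel_measurable_continuous_on_restrict) fact
  ultimately show ?thesis by (simp cong: measurable_cong_sets)
qed

text \<open>The functionals \<open>\<mu> \<mapsto> \<integral> f n d\<mu>\<close> are weakly continuous, decrease in \<open>n\<close>, and tend to \<open>0\<close> by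
  dominated convergence at every law concentrated on \<open>G\<close>; Dini's theorem on the compact closure of
  \<open>\<P>\<close> then makes the convergence uniform. That the limit laws are still concentrated on \<open>G\<close>, so that
  the pointwise limit is \<open>0\<close> on the whole closure, is where the continuity of the
  indicator of \<open>G\<close> enters.\<close>

lemma Dini_weakly_compact:
  fixes f :: "nat \<Rightarrow> (real \<Rightarrow>\<^sub>C (real^'d)) \<Rightarrow> real" and \<P> :: "(real \<Rightarrow>\<^sub>C (real^'d)) measure set"
  assumes comp: "compactin (path_weak_topology T) (path_weak_topology T closure_of \<P>)"
    and P: "\<P> \<subseteq> path_prob_measures T"
    and f: "\<And>n. continuous_on (path_space T) (f n)"
    and f01: "\<And>n w. w \<in> path_space T \<Longrightarrow> 0 \<le> f n w \<and> f n w \<le> 1"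
    and dec: "\<And>n w. w \<in> path_space T \<Longrightarrow> f (Suc n) w \<le> f n w"
    and G: "continuous_on (path_space T) (indicator G :: _ \<Rightarrow> real)"
    and full: "\<And>\<mu>. \<mu> \<in> \<P> \<Longrightarrow> AE w in \<mu>. w \<in> G"
    and lim: "\<And>w. w \<in> path_space T \<Longrightarrow> w \<in> G \<Longrightarrow> (\<lambda>n. f n w) \<longlonglongrightarrow> 0"
    and \<delta>: "0 < \<delta>"
  shows "\<exists>N. \<forall>n\<ge>N. \<forall>\<mu>\<in>\<P>. (\<integral>w. f n w \<partial>\<mu>) < \<delta>"
proof -
  let ?K = "path_weak_topology T closure_of \<P>"
  let ?V = "\<lambda>n. {\<mu>\<in>path_prob_measures T. (\<integral>w. f n w \<partial>\<mu>) \<in> {..<\<delta>}}"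
  have bd: "bounded (f n ` path_space T)" for n
    using f01 by (intro boundedI[of _ 1]) auto
  have V: "openin (path_weak_topology T) (?V n)" for n
    by (intro openin_path_weak_topology f bd) simp
  have K: "?K \<subseteq> path_prob_measures T"
    using closure_of_subset_topspace[of "path_weak_topology T" \<P>] by (simp add: topspace_path_weak_topology)
  have int: "integrable \<mu> (f n)" if "\<mu> \<in> path_prob_measures T" for \<mu> n
  proof -
    interpret prob_space \<mu> using that by (simp add: path_prob_measures_def)
    show ?thesis
      using f01 path_prob_measure_borel[OF that f]
      by (intro integrable_const_bound[of _ 1]) (auto simp: space_path_prob_measure[OF that])
  qed
  have fullK: "AE w in \<mu>. w \<in> G" if \<mu>: "\<mu> \<in> ?K" for \<mu>
  proof -
    have pm: "\<mu> \<in> path_prob_measures T" using \<mu> K by auto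
    interpret prob_space \<mu> using pm by (simp add: path_prob_measures_def)
    let ?U = "{\<nu>\<in>path_prob_measures T. (\<integral>w. indicator G w \<partial>\<nu>) \<in> - {1::real}}"
    have G_int: "(\<integral>w. indicator G w \<partial>\<nu>) = measure \<nu> (G \<inter> space \<nu>)" for \<nu> :: "(real \<Rightarrow>\<^sub>C (real^'d)) measure"
      by simp
    have "openin (path_weak_topology T) ?U"
      by (intro openin_path_weak_topology G) (auto intro!: boundedI[of _ 1])
    moreover have "\<nu> \<notin> ?U" if "\<nu> \<in> \<P>" for \<nu>
    proof -
      have "\<nu> \<in> path_prob_measures T" using that P by auto
      then interpret N: prob_space \<nu> by (simp add: path_prob_measures_def)
      have "(\<integral>w. indicator G w \<partial>\<nu>) = (\<integral>w. (1::real) \<partial>\<nu>)"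
        using full[OF that] path_prob_measure_borel[OF \<open>\<nu> \<in> path_prob_measures T\<close> G]
        by (intro integral_cong_AE) auto
      then show ?thesis by (simp add: N.prob_space)
    qed
    \<comment> \<open>A weak neighbourhood of \<open>\<mu>\<close> missed by all of \<open>\<P>\<close> would contradict \<open>\<mu>\<close> being in the closure.\<close>
    ultimately have "\<mu> \<notin> ?U"
      using \<mu> unfolding in_closure_of by (metis (no_types, lifting))
    then have one: "(\<integral>w. indicator G w \<partial>\<mu>) = (1::real)" using pm by auto
    have Gset: "G \<inter> space \<mu> \<in> sets \<mu>"
      using measurable_sets[OF path_prob_measure_borel[OF pm G], of "{1}"]
      by (auto simp: indicator_def vimage_def Int_def conj_commute if_distrib cong: if_cong)
    have "prob (G \<inter> space \<mu>) = 1" using one by (simp add: G_int)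
    then have "AE w in \<mu>. w \<in> G \<inter> space \<mu>" using Gset by (simp add: prob_eq_1)
    then show ?thesis by auto
  qed
  have "?K \<subseteq> (\<Union>n. ?V n)"
  proof
    fix \<mu> assume \<mu>: "\<mu> \<in> ?K"
    then have pm: "\<mu> \<in> path_prob_measures T" using K by auto
    interpret prob_space \<mu> using pm by (simp add: path_prob_measures_def)
    have "(\<lambda>n. \<integral>w. f n w \<partial>\<mu>) \<longlonglongrightarrow> (\<integral>w. 0 \<partial>\<mu>)"
    proof (rule integral_dominated_convergence[where w="\<lambda>_. 1"])
      show "AE w in \<mu>. (\<lambda>n. f n w) \<longlonglongrightarrow> 0"
        using fullK[OF \<mu>] AE_space by eventually_elim (auto simp: space_path_prob_measure[OF pm] lim)
      show "AE w in \<mu>. norm (f n w) \<le> 1" for n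
        using f01 by (intro AE_I2) (auto simp: space_path_prob_measure[OF pm])
    qed (auto intro: path_prob_measure_borel[OF pm f])
    then have "(\<lambda>n. \<integral>w. f n w \<partial>\<mu>) \<longlonglongrightarrow> 0" by simp
    from order_tendstoD(2)[OF this \<delta>] obtain n where "(\<integral>w. f n w \<partial>\<mu>) < \<delta>"
      by (auto simp: eventually_sequentially)
    then show "\<mu> \<in> (\<Union>n. ?V n)" using pm by auto
  qed
  then have "\<exists>\<F>. finite \<F> \<and> \<F> \<subseteq> range ?V \<and> ?K \<subseteq> \<Union>\<F>"
    using V by (intro compactinD[OF comp]) auto
  then obtain \<F> where \<F>: "finite \<F>" "\<F> \<subseteq> range ?V" "?K \<subseteq> \<Union>\<F>" by (elim exE conjE)
  from finite_subset_image[OF \<F>(1,2)] obtain F where F: "finite F" "\<F> = ?V ` F" by auto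
  have "\<P> \<subseteq> ?K"
    using P by (intro closure_of_subset) (simp add: topspace_path_weak_topology)
  show ?thesis
  proof (intro exI allI impI ballI)
    \<comment> \<open>The extra \<open>0\<close> gives \<open>Max\<close> a nonempty argument.\<close>
    fix n \<mu> assume n: "Max (insert 0 F) \<le> n" and \<mu>: "\<mu> \<in> \<P>"
    have pm: "\<mu> \<in> path_prob_measures T" using \<mu> P by auto
    have "\<mu> \<in> ?K" using \<open>\<P> \<subseteq> ?K\<close> \<mu> by (rule subsetD)
    with \<F>(3) have "\<mu> \<in> \<Union>\<F>" by (rule subsetD)
    then obtain k where k: "k \<in> F" "(\<integral>w. f k w \<partial>\<mu>) < \<delta>" by (auto simp: F(2))
    have "k \<le> n" using k(1) n F(1) by simp
    have "f n w \<le> f k w" if "w \<in> path_space T" for w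
      using lift_Suc_antimono_le[of "\<lambda>n. f n w", OF dec[OF that] \<open>k \<le> n\<close>] .
    then have "(\<integral>w. f n w \<partial>\<mu>) \<le> (\<integral>w. f k w \<partial>\<mu>)"
      by (intro integral_mono int pm) (simp add: space_path_prob_measure[OF pm])
    then show "(\<integral>w. f n w \<partial>\<mu>) < \<delta>" using k(2) by simp
  qed
qed

section \<open>Sigma-algebras generated by coordinates, and stopping\<close>

lemma space_generated_sigma [simp]: "space (generated_sigma \<Omega> I X) = \<Omega>"
  unfolding generated_sigma_def by (intro space_measure_of) auto

lemma generated_sigma_coordinate:
  fixes X :: "'i \<Rightarrow> 'a \<Rightarrow> 'b::topological_space"
  assumes "i \<in> I" shows "X i \<in> borel_measurable (generated_sigma \<Omega> I X)"
proof (rule measurableI)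
  fix B :: "'b set" assume "B \<in> sets borel"
  then have "X i -` B \<inter> \<Omega> \<in> (\<Union>i\<in>I. {X i -` B \<inter> \<Omega> | B. B \<in> sets borel})" using assms by blast
  moreover have "(\<Union>i\<in>I. {X i -` B \<inter> \<Omega> | B. B \<in> sets borel}) \<subseteq> Pow \<Omega>" by auto
  ultimately show "X i -` B \<inter> space (generated_sigma \<Omega> I X) \<in> sets (generated_sigma \<Omega> I X)"
    by (simp add: generated_sigma_def)
qed simp

lemma measurable_generated_sigmaI:
  assumes f: "f \<in> space N \<rightarrow> \<Omega>" and X: "\<And>i. i \<in> I \<Longrightarrow> (\<lambda>x. X i (f x)) \<in> borel_measurable N"
  shows "f \<in> measurable N (generated_sigma \<Omega> I X)"
  unfolding generated_sigma_def
proof (rule measurable_measure_of)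
  fix Y assume "Y \<in> (\<Union>i\<in>I. {X i -` B \<inter> \<Omega> | B. B \<in> sets borel})"
  then obtain i B where "i \<in> I" "B \<in> sets borel" "Y = X i -` B \<inter> \<Omega>" by auto
  then show "f -` Y \<inter> space N \<in> sets N"
    using measurable_sets[OF X[of i], of B] f by (auto simp: vimage_def Int_def Pi_iff conj_commute cong: conj_cong)
qed (use f in auto)

definition stop :: "real \<Rightarrow> real \<Rightarrow> (real \<Rightarrow>\<^sub>C (real^'d)) \<Rightarrow> (real \<Rightarrow>\<^sub>C (real^'d))" where
  "stop T t w = path_of T (\<lambda>s. apply_bcontfun w (min s t))"

lemma apply_stop:
  assumes "0 < T" shows "apply_bcontfun (stop T t w) s = apply_bcontfun w (min (clamp 0 T s) t)"
proof -
  have "continuous_on {0..T} (\<lambda>s. apply_bcontfun w (min s t))"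
    by (rule continuous_on_compose2[of UNIV "apply_bcontfun w"]) (auto intro: continuous_on_min continuous_on_const continuous_on_id)
  with assms show ?thesis by (simp add: stop_def apply_path_of)
qed

text \<open>Stopping is a contraction for the uniform norm.\<close>

lemma continuous_on_stop: "0 < T \<Longrightarrow> continuous_on S (stop T t)"
proof -
  assume T: "0 < T"
  have "dist (stop T t v) (stop T t w) \<le> dist v w" for v w :: "real \<Rightarrow>\<^sub>C (real^'d)"
    by (rule dist_bound) (simp add: apply_stop[OF T] dist_bounded)
  then show ?thesis
    unfolding continuous_on_iff by (meson le_less_trans)
qed

lemma stop_in_path_space: "0 < T \<Longrightarrow> 0 \<le> t \<Longrightarrow> w \<in> path_space T \<Longrightarrow> stop T t w \<in> path_space T"
  by (auto simp: path_space_def apply_stop clamp_real)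

lemma continuous_on_MIN_atMost:
  fixes g :: "nat \<Rightarrow> 'b::topological_space \<Rightarrow> real"
  assumes "\<And>i. continuous_on S (g i)"
  shows "continuous_on S (\<lambda>w. MIN i\<in>{..n}. g i w)"
proof (induction n)
  case (Suc n)
  have "(MIN i\<in>{..Suc n}. g i w) = min (g (Suc n) w) (MIN i\<in>{..n}. g i w)" for w
    by (simp add: atMost_Suc)
  then show ?case using Suc assms by (simp add: continuous_on_min)
qed (use assms in simp)

lemma MIN_atMost_tendsto_INF:
  fixes a :: "nat \<Rightarrow> real"
  assumes "(INF n. ereal (a n)) = ereal l"
  shows "(\<lambda>n. MIN i\<in>{..n}. a i) \<longlonglongrightarrow> l"
proof (rule LIMSEQ_I)
  fix r :: real assume r: "0 < r"
  have l: "l \<le> a n" for n using INF_lower[of n UNIV "\<lambda>n. ereal (a n)"] assms by simp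
  have "\<exists>n. ereal (a n) < ereal (l + r)"
  proof (rule ccontr)
    assume "\<nexists>n. ereal (a n) < ereal (l + r)"
    then have "ereal (l + r) \<le> (INF n. ereal (a n))" by (intro INF_greatest) (auto simp: not_less)
    then show False using assms r by simp
  qed
  then obtain k where k: "a k < l + r" by auto
  have "norm ((MIN i\<in>{..n}. a i) - l) < r" if "k \<le> n" for n
  proof -
    have "(MIN i\<in>{..n}. a i) \<le> a k" using that by (intro Min_le) auto
    moreover have "l \<le> (MIN i\<in>{..n}. a i)" using l by (subst Min_ge_iff) auto
    ultimately show ?thesis using k by simp
  qed
  then show "\<exists>n0. \<forall>n\<ge>n0. norm ((MIN i\<in>{..n}. a i) - l) < r" by blast
qed

section \<open>Random variables on the product of scenarios and volatilities\<close>

context volatility_uncertainty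
begin

lemma space_filtration_tilde: "space (filtration_tilde M \<Theta> Wt u) = space M \<times> \<Theta>"
  by (simp add: filtration_tilde_def)

lemma Wt_measurable: "0 \<le> s \<Longrightarrow> s \<le> u \<Longrightarrow> Wt s \<in> borel_measurable (filtration_tilde M \<Theta> Wt u)"
  unfolding filtration_tilde_def by (intro generated_sigma_coordinate) auto

lemma filtration_tilde_mono:
  assumes "u \<le> v" shows "sets (filtration_tilde M \<Theta> Wt u) \<subseteq> sets (filtration_tilde M \<Theta> Wt v)"
proof
  fix A assume A: "A \<in> sets (filtration_tilde M \<Theta> Wt u)"
  have "(\<lambda>x. x) \<in> measurable (filtration_tilde M \<Theta> Wt v) (filtration_tilde M \<Theta> Wt u)"
    using assms Wt_measurable[of _ v] unfolding filtration_tilde_def[of _ _ _ u]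
    by (intro measurable_generated_sigmaI) (auto simp: space_filtration_tilde)
  from measurable_sets[OF this A] sets.sets_into_space[OF A]
  show "A \<in> sets (filtration_tilde M \<Theta> Wt v)"
    by (simp add: space_filtration_tilde vimage_def Int_absorb2)
qed

text \<open>The added null sets need not be measurable for \<open>M\<close>, hence the completion.\<close>

lemma augmented_filtration_le_completion:
  assumes "s \<le> T" shows "(\<lambda>\<omega>. \<omega>) \<in> measurable (completion M) (augmented_filtration M W s)"
  unfolding augmented_filtration_def
proof (rule measurable_measure_of)
  show "sets (generated_sigma (space M) {0..s} W) \<union> null_sets (completion M) \<subseteq> Pow (space M)"
    using sets.sets_into_space[of _ "generated_sigma (space M) {0..s} W"]
      sets.sets_into_space[of _ "completion M"] by (force simp: null_sets_def)
  have "(\<lambda>\<omega>. \<omega>) \<in> measurable (completion M) (generated_sigma (space M) {0..s} W)"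
    using W_brownian assms unfolding brownian_motion_def
    by (intro measurable_generated_sigmaI measurable_completion) auto
  then show "(\<lambda>\<omega>. \<omega>) -` Y \<inter> space (completion M) \<in> sets (completion M)"
    if "Y \<in> sets (generated_sigma (space M) {0..s} W) \<union> null_sets (completion M)" for Y
    using that measurable_sets[of "\<lambda>\<omega>. \<omega>" "completion M"] by (auto simp: null_sets_def)
qed simp

lemma section_measurable:
  assumes "\<theta> \<in> \<Theta>" "u \<le> T"
  shows "(\<lambda>\<omega>. (\<omega>, \<theta>)) \<in> measurable (completion M) (filtration_tilde M \<Theta> Wt u)"
  unfolding filtration_tilde_def
proof (rule measurable_generated_sigmaI)
  fix s assume s: "s \<in> {0..u}"
  then have "(\<lambda>\<omega>. Wt s (\<omega>, \<theta>)) \<in> borel_measurable (augmented_filtration M W s)"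
    using Wt_integral[OF assms(1)] assms(2) by (simp add: is_stochastic_integral_def)
  from measurable_compose[OF augmented_filtration_le_completion this] s assms(2)
  show "(\<lambda>\<omega>. Wt s (\<omega>, \<theta>)) \<in> borel_measurable (completion M)" by simp
qed (use assms in auto)

lemma quasi_surelyD:
  assumes Q: "quasi_surely M T \<Theta> Wt Q" and \<theta>: "\<theta> \<in> \<Theta>"
  shows "AE \<omega> in M. Q (\<omega>, \<theta>)"
proof -
  obtain B where B: "B \<in> sets (filtration_tilde M \<Theta> Wt T)"
      "{x\<in>space M \<times> \<Theta>. \<not> Q x} \<subseteq> B" "P_tilde M \<Theta> B = 0"
    using Q by (auto simp: quasi_surely_def polar_def)
  let ?N = "{\<omega>\<in>space M. (\<omega>, \<theta>) \<in> B}"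
  have "?N = (\<lambda>\<omega>. (\<omega>, \<theta>)) -` B \<inter> space (completion M)" by auto
  also have "\<dots> \<in> sets (completion M)"
    using section_measurable[OF \<theta>, of T] B(1) by (intro measurable_sets) auto
  finally have N: "?N \<in> sets (completion M)" .
  have "P_vol M \<theta> B \<le> P_tilde M \<Theta> B"
    unfolding P_tilde_def by (intro SUP_upper \<theta>)
  then have "emeasure (completion M) ?N = 0" using B(3) by (simp add: P_vol_def)
  with N have "?N \<in> null_sets (completion M)" by (simp add: null_sets_def)
  then have "AE \<omega> in completion M. Q (\<omega>, \<theta>)"
    using B(2) \<theta> by (rule_tac AE_I'[of ?N]) auto
  then show ?thesis by (simp add: AE_completion_iff)
qed

text \<open>Since polar sets need a measurable cover, almost sure validity under every \<open>\<theta>\<close> suffices only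
  for exceptional sets in the \<open>\<sigma>\<close>-algebra of the process.\<close>

lemma quasi_surelyI:
  assumes "{x\<in>space M \<times> \<Theta>. \<not> Q x} \<in> sets (filtration_tilde M \<Theta> Wt T)"
    and Q: "\<And>\<theta>. \<theta> \<in> \<Theta> \<Longrightarrow> AE \<omega> in M. Q (\<omega>, \<theta>)"
  shows "quasi_surely M T \<Theta> Wt Q"
proof -
  have "P_vol M \<theta> {x\<in>space M \<times> \<Theta>. \<not> Q x} = 0" if "\<theta> \<in> \<Theta>" for \<theta>
  proof -
    have "{\<omega>\<in>space M. (\<omega>, \<theta>) \<in> {x\<in>space M \<times> \<Theta>. \<not> Q x}} = {\<omega>\<in>space (completion M). \<not> Q (\<omega>, \<theta>)}"
      using that by auto
    moreover have "emeasure (completion M) \<dots> = 0"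
    proof (rule emeasure_eq_0_AE)
      show "AE \<omega> in completion M. \<not> \<not> Q (\<omega>, \<theta>)" using AE_completion[OF Q[OF that]] by simp
    qed
    ultimately show ?thesis by (simp add: P_vol_def)
  qed
  then have "P_tilde M \<Theta> {x\<in>space M \<times> \<Theta>. \<not> Q x} \<le> 0"
    unfolding P_tilde_def by (intro SUP_least) simp
  then show ?thesis using assms(1) by (auto simp: quasi_surely_def polar_def)
qed

lemma stopped_path_continuous:
  assumes "u \<in> {0..T}" "x \<in> space M \<times> \<Theta>"
  shows "continuous_on {0..T} (\<lambda>s. Wt (min s u) x)"
proof -
  obtain \<omega> \<theta> where x: "x = (\<omega>, \<theta>)" "\<omega> \<in> space M" "\<theta> \<in> \<Theta>" using assms(2) by auto
  show ?thesis unfolding x(1)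
    using assms(1) by (intro continuous_on_compose2[OF Wt_continuous[OF x(3,2)]] continuous_intros) auto
qed

lemma apply_stopped_path:
  assumes "u \<in> {0..T}" "x \<in> space M \<times> \<Theta>"
  shows "apply_bcontfun (stopped_path T Wt u x) s = Wt (min (clamp 0 T s) u) x"
  unfolding stopped_path_def using T_pos stopped_path_continuous[OF assms]
  by (simp add: apply_path_of)

lemma stopped_path_in_path_space:
  assumes "u \<in> {0..T}" "x \<in> space M \<times> \<Theta>"
  shows "stopped_path T Wt u x \<in> path_space T"
  unfolding stopped_path_def using T_pos assms Wt_zero
  by (intro path_of_in_path_space stopped_path_continuous[OF assms]) auto

lemma stopped_path_measurable:
  assumes "u \<in> {0..T}"
  shows "stopped_path T Wt u \<in> measurable (filtration_tilde M \<Theta> Wt u) (path_borel T)"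
proof (rule measurable_path_borelI[OF T_pos])
  fix s
  have "Wt (min (clamp 0 T s) u) \<in> borel_measurable (filtration_tilde M \<Theta> Wt u)"
    using assms T_pos by (intro Wt_measurable) (auto simp: clamp_real)
  then show "(\<lambda>x. apply_bcontfun (stopped_path T Wt u x) s) \<in> borel_measurable (filtration_tilde M \<Theta> Wt u)"
    by (subst measurable_cong[OF apply_stopped_path[OF assms]]) (auto simp: space_filtration_tilde)
qed (use stopped_path_in_path_space[OF assms] in \<open>auto simp: space_filtration_tilde\<close>)

lemma stopped_path_section_measurable:
  assumes "u \<in> {0..T}" "\<theta> \<in> \<Theta>"
  shows "(\<lambda>\<omega>. stopped_path T Wt u (\<omega>, \<theta>)) \<in> measurable (completion M) (path_borel T)"
  using measurable_compose[OF section_measurable stopped_path_measurable] assms by simp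

text \<open>The laws in the compactness hypothesis are those of the full path, while the random
  variables are functions of the path stopped at \<open>u\<close>; composing such functions with \<open>stop\<close>
  connects the two.\<close>

lemma stop_stopped_path:
  assumes "u \<in> {0..T}" "x \<in> space M \<times> \<Theta>"
  shows "stop T u (stopped_path T Wt T x) = stopped_path T Wt u x"
  using assms T_pos by (intro bcontfun_eqI) (auto simp: apply_stop apply_stopped_path clamp_real)

lemma path_law_eq:
  "path_law M T Wt \<theta> = distr (completion M) (path_borel T) (\<lambda>\<omega>. stopped_path T Wt T (\<omega>, \<theta>))"
proof -
  have "min (clamp 0 T s) T = clamp 0 T s" for s using T_pos by (simp add: clamp_real)
  then show ?thesis by (simp add: path_law_def stopped_path_def path_of_def)
qed

lemma path_law_in_path_prob_measures:
  assumes "\<theta> \<in> \<Theta>" shows "path_law M T Wt \<theta> \<in> path_prob_measures T"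
proof -
  interpret C: prob_space "completion M" by (rule prob_space_completion)
  show ?thesis
    using stopped_path_section_measurable[OF _ assms, of T] T_pos
    by (auto simp: path_prob_measures_def path_law_eq intro!: C.prob_space_distr)
qed

text \<open>Markov's inequality, transported to path space. By convention \<open>emeasure\<close> is \<open>0\<close> on
  non-measurable sets, so only the larger of the two events has to be measurable.\<close>

lemma P_vol_le_integral_path_law:
  assumes \<theta>: "\<theta> \<in> \<Theta>"
    and f: "continuous_on (path_space T) f" "\<And>w. w \<in> path_space T \<Longrightarrow> 0 \<le> f w \<and> f w \<le> 1"
    and A: "AE \<omega> in M. (\<omega>, \<theta>) \<in> A \<longrightarrow> 1 \<le> f (stopped_path T Wt T (\<omega>, \<theta>))"
  shows "P_vol M \<theta> A \<le> ennreal (\<integral>w. f w \<partial>path_law M T Wt \<theta>)"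
proof -
  let ?\<mu> = "path_law M T Wt \<theta>"
  have pm: "?\<mu> \<in> path_prob_measures T" by (rule path_law_in_path_prob_measures[OF \<theta>])
  interpret L: prob_space ?\<mu> using pm by (simp add: path_prob_measures_def)
  have [measurable]: "f \<in> borel_measurable ?\<mu>" by (rule path_prob_measure_borel[OF pm f(1)])
  have int: "integrable ?\<mu> f"
    using f(2) by (intro L.integrable_const_bound[of _ 1]) (auto simp: space_path_prob_measure[OF pm])
  let ?B = "{w\<in>space ?\<mu>. 1 \<le> f w}"
  have B: "?B \<in> sets ?\<mu>" by measurable
  have meas: "(\<lambda>\<omega>. stopped_path T Wt T (\<omega>, \<theta>)) \<in> measurable (completion M) (path_borel T)"
    using stopped_path_section_measurable[OF _ \<theta>, of T] T_pos by simp
  have B': "?B \<in> sets (path_borel T)" using B by (simp add: path_law_eq)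
  have "P_vol M \<theta> A \<le> emeasure (completion M) ((\<lambda>\<omega>. stopped_path T Wt T (\<omega>, \<theta>)) -` ?B \<inter> space (completion M))"
    unfolding P_vol_def
  proof (rule emeasure_mono_AE)
    show "AE \<omega> in completion M. \<omega> \<in> {\<omega>\<in>space M. (\<omega>, \<theta>) \<in> A} \<longrightarrow>
        \<omega> \<in> (\<lambda>\<omega>. stopped_path T Wt T (\<omega>, \<theta>)) -` ?B \<inter> space (completion M)"
      using AE_completion[OF A]
    proof eventually_elim
      case (elim \<omega>)
      then show ?case
        using stopped_path_in_path_space[of T "(\<omega>, \<theta>)"] \<theta> T_pos by (auto simp: space_path_prob_measure[OF pm])
    qed
  qed (use measurable_sets[OF meas B'] in simp)
  also have "\<dots> = emeasure ?\<mu> ?B"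
    unfolding path_law_eq[of \<theta>] by (rule emeasure_distr[symmetric, OF meas]) (use B' in \<open>simp add: path_law_eq\<close>)
  also have "\<dots> \<le> ennreal ((1 / 1) * (\<integral>w. f w \<partial>?\<mu>))"
    using f(2) by (intro integral_Markov_inequality int AE_I2) (auto simp: space_path_prob_measure[OF pm])
  finally show ?thesis by simp
qed

text \<open>The event in question is contained, up to null sets, in the event that the truncated
  excess \<open>min 1 ((MIN i\<le>n. g i - \<psi>)\<^sup>+ / \<epsilon>)\<close>, evaluated along the stopped path, equals \<open>1\<close>. By Markov's
  inequality its probability is at most the integral of that function under the law of the path, and
  these integrals tend to \<open>0\<close> uniformly over the laws by Dini's theorem.\<close>

lemma MIN_tendsto_in_capacity:
  fixes g :: "nat \<Rightarrow> (real \<Rightarrow>\<^sub>C (real^'d)) \<Rightarrow> real" and X :: "nat \<Rightarrow> 'a \<times> ('a, 'd) vol \<Rightarrow> real"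
    and Z :: "'a \<times> ('a, 'd) vol \<Rightarrow> ereal"
  assumes t: "t \<in> {0..T}"
    and comp: "compactin (path_weak_topology T) (path_weak_topology T closure_of (path_law M T Wt ` \<Theta>))"
    and g: "\<And>n. continuous_on (path_space T) (g n)" and \<psi>: "continuous_on (path_space T) \<psi>"
    and G: "continuous_on (path_space T) (indicator G :: _ \<Rightarrow> real)"
    and lim: "\<And>w. w \<in> path_space T \<Longrightarrow> w \<in> G \<Longrightarrow> (INF n. ereal (g n w)) = ereal (\<psi> w)"
    and full: "\<And>\<theta>. \<theta> \<in> \<Theta> \<Longrightarrow> AE \<omega> in M. stopped_path T Wt t (\<omega>, \<theta>) \<in> G"
    and X: "\<And>n \<theta>. \<theta> \<in> \<Theta> \<Longrightarrow> AE \<omega> in M. X n (\<omega>, \<theta>) = g n (stopped_path T Wt t (\<omega>, \<theta>))"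
    and Z: "\<And>\<theta>. \<theta> \<in> \<Theta> \<Longrightarrow> AE \<omega> in M. Z (\<omega>, \<theta>) = ereal (\<psi> (stopped_path T Wt t (\<omega>, \<theta>)))"
    and \<epsilon>: "0 < \<epsilon>"
  shows "(\<lambda>n. P_tilde M \<Theta> {x \<in> space M \<times> \<Theta>.
            ereal \<epsilon> < ereal (MIN i\<in>{..n}. X i x) - Z x}) \<longlonglongrightarrow> 0"
proof -
  define h where "h n w = min 1 (max 0 (((MIN i\<in>{..n}. g i w) - \<psi> w) / \<epsilon>))" for n w
  define f where "f n w = h n (stop T t w)" for n w
  have stop: "stop T t w \<in> path_space T" if "w \<in> path_space T" for w :: "real \<Rightarrow>\<^sub>C (real^'d)"
    using that t T_pos by (intro stop_in_path_space) auto
  have compose: "continuous_on (path_space T) (\<lambda>w. k (stop T t w))"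
    if "continuous_on (path_space T) k" for k :: "(real \<Rightarrow>\<^sub>C (real^'d)) \<Rightarrow> real"
    by (rule continuous_on_compose2[OF that continuous_on_stop[OF T_pos]]) (use stop in auto)
  have f_cont: "continuous_on (path_space T) (f n)" for n
    unfolding f_def[abs_def] using \<epsilon>
    by (intro compose) (auto simp: h_def[abs_def] intro!: continuous_intros continuous_on_MIN_atMost g \<psi>)
  have f01: "0 \<le> f n w \<and> f n w \<le> 1" for n w by (simp add: f_def h_def)
  have dec: "f (Suc n) w \<le> f n w" for n w
  proof -
    let ?v = "stop T t w"
    have "(MIN i\<in>{..Suc n}. g i ?v) \<le> (MIN i\<in>{..n}. g i ?v)" by (intro Min_antimono) auto
    then have "((MIN i\<in>{..Suc n}. g i ?v) - \<psi> ?v) / \<epsilon> \<le> ((MIN i\<in>{..n}. g i ?v) - \<psi> ?v) / \<epsilon>"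
      using \<epsilon> by (intro divide_right_mono) auto
    then show ?thesis unfolding f_def h_def by linarith
  qed
  let ?G = "{w. stop T t w \<in> G}"
  have G_cont: "continuous_on (path_space T) (indicator ?G :: _ \<Rightarrow> real)"
    using compose[OF G] by (simp add: indicator_def)
  have G_full: "AE w in \<mu>. w \<in> ?G" if \<mu>: "\<mu> \<in> path_law M T Wt ` \<Theta>" for \<mu>
  proof -
    obtain \<theta> where \<theta>: "\<theta> \<in> \<Theta>" "\<mu> = path_law M T Wt \<theta>" using \<mu> by auto
    have pm: "\<mu> \<in> path_prob_measures T" using \<theta> path_law_in_path_prob_measures by simp
    have "{w\<in>space \<mu>. (indicator ?G w :: real) = 1} \<in> sets \<mu>"
      using path_prob_measure_borel[OF pm G_cont] by measurable
    then have "{w\<in>space \<mu>. w \<in> ?G} \<in> sets \<mu>" by (simp only: indicator_eq_1_iff)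
    then have set: "{w\<in>space (path_borel T). w \<in> ?G} \<in> sets (path_borel T)"
      using pm sets_eq_imp_space_eq[of \<mu> "path_borel T"] by (simp add: path_prob_measures_def)
    have meas: "(\<lambda>\<omega>. stopped_path T Wt T (\<omega>, \<theta>)) \<in> measurable (completion M) (path_borel T)"
      using stopped_path_section_measurable[OF _ \<theta>(1), of T] T_pos by simp
    have "AE \<omega> in completion M. stopped_path T Wt T (\<omega>, \<theta>) \<in> ?G"
      using AE_completion[OF full[OF \<theta>(1)]] AE_space
    proof eventually_elim
      case (elim \<omega>)
      then show ?case using stop_stopped_path[OF t, of "(\<omega>, \<theta>)"] \<theta>(1) by simp
    qed
    then show ?thesis unfolding \<theta>(2) path_law_eq by (subst AE_distr_iff[OF meas set])
  qed
  have f_lim: "(\<lambda>n. f n w) \<longlonglongrightarrow> 0" if "w \<in> path_space T" "w \<in> ?G" for w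
  proof -
    let ?v = "stop T t w"
    have "(\<lambda>n. MIN i\<in>{..n}. g i ?v) \<longlonglongrightarrow> \<psi> ?v"
      using that stop by (intro MIN_atMost_tendsto_INF lim) auto
    then have "(\<lambda>n. f n w) \<longlonglongrightarrow> min 1 (max 0 ((\<psi> ?v - \<psi> ?v) / \<epsilon>))"
      unfolding f_def h_def using \<epsilon> by (intro tendsto_intros) auto
    then show ?thesis by simp
  qed
  let ?A = "\<lambda>n. {x \<in> space M \<times> \<Theta>. ereal \<epsilon> < ereal (MIN i\<in>{..n}. X i x) - Z x}"
  have A: "AE \<omega> in M. (\<omega>, \<theta>) \<in> ?A n \<longrightarrow> 1 \<le> f n (stopped_path T Wt T (\<omega>, \<theta>))" if \<theta>: "\<theta> \<in> \<Theta>" for n \<theta>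
  proof -
    have "AE \<omega> in M. \<forall>i. X i (\<omega>, \<theta>) = g i (stopped_path T Wt t (\<omega>, \<theta>))"
      using X[OF \<theta>] by (simp add: AE_all_countable)
    with Z[OF \<theta>] AE_space show ?thesis
    proof eventually_elim
      case (elim \<omega>)
      let ?v = "stopped_path T Wt t (\<omega>, \<theta>)"
      define a where "a = (MIN i\<in>{..n}. g i ?v)"
      have stop_v: "stop T t (stopped_path T Wt T (\<omega>, \<theta>)) = ?v"
        using elim \<theta> by (intro stop_stopped_path t) auto
      have MIN_X: "(MIN i\<in>{..n}. X i (\<omega>, \<theta>)) = a"
        using elim by (simp add: a_def)
      show ?case
      proof
        assume "(\<omega>, \<theta>) \<in> ?A n"
        then have "ereal \<epsilon> < ereal a - ereal (\<psi> ?v)" using elim(1) MIN_X by simp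
        then have "1 \<le> (a - \<psi> ?v) / \<epsilon>" using \<epsilon> by (simp add: field_simps)
        then show "1 \<le> f n (stopped_path T Wt T (\<omega>, \<theta>))"
          by (simp add: f_def h_def stop_v a_def[symmetric])
      qed
    qed
  qed
  show ?thesis
  proof (rule order_tendstoI)
    fix a :: ennreal assume "0 < a"
    then obtain b where b: "0 < b" "b < a" using dense by blast
    then obtain \<delta> where \<delta>: "0 < \<delta>" "b = ennreal \<delta>"
      by (cases b) (auto simp: ennreal_less_zero_iff)
    have "\<exists>N. \<forall>n\<ge>N. \<forall>\<mu>\<in>path_law M T Wt ` \<Theta>. (\<integral>w. f n w \<partial>\<mu>) < \<delta>"
      by (rule Dini_weakly_compact[OF comp _ f_cont f01 dec G_cont G_full f_lim \<delta>(1)])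
        (use path_law_in_path_prob_measures in auto)
    then obtain N where N: "\<And>n \<theta>. N \<le> n \<Longrightarrow> \<theta> \<in> \<Theta> \<Longrightarrow> (\<integral>w. f n w \<partial>path_law M T Wt \<theta>) < \<delta>" by auto
    have "P_tilde M \<Theta> (?A n) < a" if "N \<le> n" for n
    proof -
      have "P_vol M \<theta> (?A n) \<le> b" if \<theta>: "\<theta> \<in> \<Theta>" for \<theta>
      proof -
        have "P_vol M \<theta> (?A n) \<le> ennreal (\<integral>w. f n w \<partial>path_law M T Wt \<theta>)"
          by (rule P_vol_le_integral_path_law[OF \<theta> f_cont f01 A[OF \<theta>]])
        also have "\<dots> \<le> b" unfolding \<delta>(2) using N[OF \<open>N \<le> n\<close> \<theta>] by (intro ennreal_leI) simp
        finally show ?thesis .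
      qed
      then have "P_tilde M \<Theta> (?A n) \<le> b" unfolding P_tilde_def by (intro SUP_least)
      then show ?thesis using b(2) by simp
    qed
    then show "\<forall>\<^sub>F n in sequentially. P_tilde M \<Theta> (?A n) < a" by (auto simp: eventually_sequentially)
  qed simp
qed

end

section \<open>The infimum of a family with common modulus\<close>

theorem proposition2p2:
  fixes M :: "'a measure" and T t :: real and W :: "real \<Rightarrow> 'a \<Rightarrow> real^'d"
    and \<Theta> :: "('a, 'd::finite) vol set" and Wt :: "real \<Rightarrow> 'a \<times> ('a, 'd) vol \<Rightarrow> real^'d"
    and \<MM> :: "(ennreal \<Rightarrow> ennreal) set" and m :: "ennreal \<Rightarrow> ennreal"
    and \<X> :: "('a \<times> ('a, 'd) vol \<Rightarrow> real) set"
  assumes "volatility_uncertainty M T W \<Theta> Wt"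
    and "t \<in> {0..T}"
    and "countable \<MM>" and "\<forall>m'\<in>\<MM>. modulus_of_continuity m'" and "m \<in> \<MM>"
    and "\<X> \<subseteq> C_mod M T \<Theta> Wt m t" and "\<X> \<noteq> {}"
    and "\<exists>c::real. \<forall>X\<in>\<X>. quasi_surely M T \<Theta> Wt (\<lambda>x. c \<le> X x)"
  shows "(\<exists>Y\<in>C_mod M T \<Theta> Wt m t.
            quasi_surely M T \<Theta> Wt (\<lambda>x. X_star M T \<Theta> Wt m t \<X> x = ereal (Y x)))
       \<and> (\<forall>\<theta>\<in>\<Theta>. \<exists>X :: nat \<Rightarrow> 'a \<times> ('a, 'd) vol \<Rightarrow> real. range X \<subseteq> \<X> \<and>
            (AE \<omega> in M. X_star M T \<Theta> Wt m t \<X> (\<omega>, \<theta>) = (INF n. ereal (X n (\<omega>, \<theta>)))))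
       \<and> (compactin (path_weak_topology T)
              (path_weak_topology T closure_of (path_law M T Wt ` \<Theta>)) \<longrightarrow>
          (\<exists>X :: nat \<Rightarrow> 'a \<times> ('a, 'd) vol \<Rightarrow> real. range X \<subseteq> \<X> \<and>
            (\<forall>\<epsilon>::real. 0 < \<epsilon> \<longrightarrow>
              (\<lambda>n. P_tilde M \<Theta> {x \<in> space M \<times> \<Theta>.
                 ereal \<epsilon> < ereal (MIN i\<in>{..n}. X i x) - X_star M T \<Theta> Wt m t \<X> x}) \<longlonglongrightarrow> 0)))"
proof -
  interpret volatility_uncertainty M T W \<Theta> Wt by fact
  let ?stopped = "stopped_path T Wt t"
  have t: "t \<in> {0..T}" by fact
  have m: "modulus_of_continuity m" using assms(4,5) by blast
  obtain c :: real where c: "\<And>X. X \<in> \<X> \<Longrightarrow> quasi_surely M T \<Theta> Wt (\<lambda>x. c \<le> X x)"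
    using assms(8) by blast
  \<comment> \<open>The representing functions whose infimum \<open>I\<close> is \<open>phi_star\<close>; \<open>\<psi>\<close> is its real-valued version.\<close>
  define \<Phi> where "\<Phi> = {\<phi>. has_modulus T m \<phi> \<and>
      (\<exists>X\<in>\<X>. quasi_surely M T \<Theta> Wt (\<lambda>x. X x = \<phi> (?stopped x)))}"
  define I where "I w = (INF \<phi>\<in>\<Phi>. ereal (\<phi> w))" for w
  define \<psi> where "\<psi> w = real_of_ereal (I w)" for w
  let ?G = "{w. I w \<noteq> -\<infinity>}"
  have star: "X_star M T \<Theta> Wt m t \<X> x = I (?stopped x)" for x
    by (simp add: X_star_def phi_star_def I_def \<Phi>_def)
  have \<Phi>: "has_modulus T m \<phi>" if "\<phi> \<in> \<Phi>" for \<phi> using that by (simp add: \<Phi>_def)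
  obtain X0 where X0: "X0 \<in> \<X>" using assms(7) by blast
  then have "X0 \<in> C_mod M T \<Theta> Wt m t" using assms(6) by blast
  then obtain \<phi>0 where "\<phi>0 \<in> \<Phi>" using X0 by (auto simp: C_mod_def \<Phi>_def)
  then have ne: "\<Phi> \<noteq> {}" by blast
  obtain f :: "nat \<Rightarrow> _" where f: "range f \<subseteq> \<Phi>"
      "\<And>w. w \<in> path_space T \<Longrightarrow> (INF n. ereal (f n w)) = (INF \<phi>\<in>\<Phi>. ereal (\<phi> w))"
    using countable_subfamily_same_INF[OF path_space_small_cells[OF T_pos]
        has_modulus_continuous_on[OF m \<Phi>] ne] by blast
  have f\<Phi>: "f n \<in> \<Phi>" for n using f(1) by blast
  have f_INF: "(INF n. ereal (f n w)) = I w" if "w \<in> path_space T" for w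
    using f(2)[OF that] by (simp add: I_def)
  have "\<forall>n. \<exists>Y. Y \<in> \<X> \<and> quasi_surely M T \<Theta> Wt (\<lambda>x. Y x = f n (?stopped x))"
    using f\<Phi> by (auto simp: \<Phi>_def)
  from choice[OF this] obtain X
    where X: "\<forall>n. X n \<in> \<X> \<and> quasi_surely M T \<Theta> Wt (\<lambda>x. X n x = f n (?stopped x))" ..
  have X_ae: "AE \<omega> in M. X n (\<omega>, \<theta>) = f n (?stopped (\<omega>, \<theta>))" if "\<theta> \<in> \<Theta>" for n \<theta>
    using quasi_surelyD[OF _ that] X by blast
  have in_E: "?stopped (\<omega>, \<theta>) \<in> path_space T" if "\<omega> \<in> space M" "\<theta> \<in> \<Theta>" for \<omega> \<theta>
    using that by (intro stopped_path_in_path_space t) simp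
  have I_ereal: "I w = ereal (\<psi> w)" if "I w \<noteq> -\<infinity>" for w
  proof -
    have "I w \<le> ereal (\<phi>0 w)" unfolding I_def by (rule INF_lower) fact
    then show ?thesis using that by (cases "I w") (auto simp: \<psi>_def)
  qed
  \<comment> \<open>Countably many \<open>f n\<close> determine \<open>I\<close>, so the lower bounds \<open>c\<close>, each valid only almost surely,
    combine into one for \<open>I\<close>.\<close>
  have full: "AE \<omega> in M. ?stopped (\<omega>, \<theta>) \<in> ?G" if \<theta>: "\<theta> \<in> \<Theta>" for \<theta>
  proof -
    have "AE \<omega> in M. \<forall>n. X n (\<omega>, \<theta>) = f n (?stopped (\<omega>, \<theta>))"
      using X_ae[OF \<theta>] by (simp add: AE_all_countable)
    moreover have "AE \<omega> in M. \<forall>n. c \<le> X n (\<omega>, \<theta>)"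
      using quasi_surelyD[OF c \<theta>] X by (simp add: AE_all_countable)
    ultimately show ?thesis using AE_space
    proof eventually_elim
      case (elim \<omega>)
      then have "ereal c \<le> (INF n. ereal (f n (?stopped (\<omega>, \<theta>))))" by (intro INF_greatest) simp
      also have "\<dots> = I (?stopped (\<omega>, \<theta>))" using elim \<theta> by (intro f_INF in_E)
      finally show ?case by auto
    qed
  qed
  have star_ae: "AE \<omega> in M. X_star M T \<Theta> Wt m t \<X> (\<omega>, \<theta>) = ereal (\<psi> (?stopped (\<omega>, \<theta>)))"
    if "\<theta> \<in> \<Theta>" for \<theta>
    using full[OF that] unfolding star
  proof eventually_elim
    case (elim \<omega>)
    then show ?case by (intro I_ereal) simp
  qed
  have \<psi>_mod: "has_modulus T m \<psi>"
    unfolding \<psi>_def[abs_def] I_def by (rule has_modulus_INF[OF \<Phi> ne])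
  have comp_meas: "(\<lambda>x. g (?stopped x)) \<in> borel_measurable (filtration_tilde M \<Theta> Wt t)"
    if "continuous_on (path_space T) g" for g :: "(real \<Rightarrow>\<^sub>C (real^'d)) \<Rightarrow> real"
  proof (rule measurable_compose[OF stopped_path_measurable[OF t]])
    show "g \<in> borel_measurable (path_borel T)"
      unfolding path_borel_def by (rule borel_measurable_continuous_on_restrict[OF that])
  qed
  have f_cont: "continuous_on (path_space T) (f n)" for n
    by (rule has_modulus_continuous_on[OF m \<Phi>[OF f\<Phi>]])
  have \<psi>_cont: "continuous_on (path_space T) \<psi>"
    by (rule has_modulus_continuous_on[OF m \<psi>_mod])
  have part1: "\<exists>Y\<in>C_mod M T \<Theta> Wt m t.
      quasi_surely M T \<Theta> Wt (\<lambda>x. X_star M T \<Theta> Wt m t \<X> x = ereal (Y x))"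
  proof (rule bexI[of _ "\<lambda>x. \<psi> (?stopped x)"])
    have "quasi_surely M T \<Theta> Wt (\<lambda>x. \<psi> (?stopped x) = \<psi> (?stopped x))"
      by (rule quasi_surelyI) simp_all
    then show "(\<lambda>x. \<psi> (?stopped x)) \<in> C_mod M T \<Theta> Wt m t"
      using \<psi>_mod comp_meas[OF \<psi>_cont] unfolding C_mod_def by blast
    show "quasi_surely M T \<Theta> Wt (\<lambda>x. X_star M T \<Theta> Wt m t \<X> x = ereal (\<psi> (?stopped x)))"
    proof (rule quasi_surelyI[OF _ star_ae])
      \<comment> \<open>Measurability of the exceptional set comes from rewriting the infimum as a countable one.\<close>
      let ?F = "filtration_tilde M \<Theta> Wt t"
      note comp_meas[OF f_cont, measurable] comp_meas[OF \<psi>_cont, measurable]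
      have "{x\<in>space M \<times> \<Theta>. \<not> X_star M T \<Theta> Wt m t \<X> x = ereal (\<psi> (?stopped x))} =
          {x\<in>space ?F. \<not> (INF n. ereal (f n (?stopped x))) = ereal (\<psi> (?stopped x))}"
        using f_INF[OF stopped_path_in_path_space[OF t]] by (auto simp: star space_filtration_tilde)
      also have "\<dots> \<in> sets ?F" by measurable
      finally show "{x\<in>space M \<times> \<Theta>. \<not> X_star M T \<Theta> Wt m t \<X> x = ereal (\<psi> (?stopped x))}
          \<in> sets (filtration_tilde M \<Theta> Wt T)"
        using filtration_tilde_mono[of t T] t by auto
    qed
  qed
  have part2: "AE \<omega> in M. X_star M T \<Theta> Wt m t \<X> (\<omega>, \<theta>) = (INF n. ereal (X n (\<omega>, \<theta>)))"
    if \<theta>: "\<theta> \<in> \<Theta>" for \<theta>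
  proof -
    have "AE \<omega> in M. \<forall>n. X n (\<omega>, \<theta>) = f n (?stopped (\<omega>, \<theta>))"
      using X_ae[OF \<theta>] by (simp add: AE_all_countable)
    with AE_space show ?thesis
    proof eventually_elim
      case (elim \<omega>)
      have "(INF n. ereal (X n (\<omega>, \<theta>))) = (INF n. ereal (f n (?stopped (\<omega>, \<theta>))))"
        using elim(2) by (intro INF_cong) simp_all
      also have "\<dots> = I (?stopped (\<omega>, \<theta>))" using elim(1) \<theta> by (intro f_INF in_E)
      finally show ?case unfolding star ..
    qed
  qed
  have part3: "(\<lambda>n. P_tilde M \<Theta> {x \<in> space M \<times> \<Theta>.
      ereal \<epsilon> < ereal (MIN i\<in>{..n}. X i x) - X_star M T \<Theta> Wt m t \<X> x}) \<longlonglongrightarrow> 0"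
    if "compactin (path_weak_topology T) (path_weak_topology T closure_of (path_law M T Wt ` \<Theta>))"
      and "0 < \<epsilon>" for \<epsilon>
  proof (rule MIN_tendsto_in_capacity[OF t that(1) f_cont \<psi>_cont _ _ full X_ae star_ae that(2)])
    show "continuous_on (path_space T) (indicator ?G :: _ \<Rightarrow> real)"
      unfolding I_def by (rule continuous_on_indicator_INF_finite[OF m \<Phi>])
    show "(INF n. ereal (f n w)) = ereal (\<psi> w)" if "w \<in> path_space T" "w \<in> ?G" for w
      using f_INF[OF that(1)] I_ereal[of w] that(2) by simp
  qed
  have "range X \<subseteq> \<X>" using X by blast
  show ?thesis
  proof (intro conjI ballI impI)
    show "\<exists>X :: nat \<Rightarrow> _. range X \<subseteq> \<X> \<and> (AE \<omega> in M. X_star M T \<Theta> Wt m t \<X> (\<omega>, \<theta>) = (INF n. ereal (X n (\<omega>, \<theta>))))"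
      if "\<theta> \<in> \<Theta>" for \<theta>
      using \<open>range X \<subseteq> \<X>\<close> part2[OF that] by (intro exI[of _ X] conjI)
    show "\<exists>X :: nat \<Rightarrow> _. range X \<subseteq> \<X> \<and> (\<forall>\<epsilon>::real. 0 < \<epsilon> \<longrightarrow> (\<lambda>n. P_tilde M \<Theta> {x \<in> space M \<times> \<Theta>.
        ereal \<epsilon> < ereal (MIN i\<in>{..n}. X i x) - X_star M T \<Theta> Wt m t \<X> x}) \<longlonglongrightarrow> 0)"
      if "compactin (path_weak_topology T) (path_weak_topology T closure_of (path_law M T Wt ` \<Theta>))"
      using \<open>range X \<subseteq> \<X>\<close> part3[OF that] by (intro exI[of _ X] conjI allI impI)
  qed (rule part1)
qed

end
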